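(* Let $J:\mathbf{Unitary}\to\mathbf{Isometry}$ be the inclusion (identity on objects and on matrices); it is a strict bipermutative functor. For every bipermutative category $\mathcal{C}$ whose additive unit $N$ is an initial object, and every strict bipermutative functor $F:\mathbf{Unitary}\to\mathcal{C}$, there exists a unique strict bipermutative functor $\widehat F:\mathbf{Isometry}\to\mathcal{C}$ such that $\widehat F\circ J = F$.
   Context: A bipermutative category is a category $\mathcal{C}$ with two strict symmetric monoidal structures $(\oplus,N,\gamma)$ and $(\otimes,I,\gamma')$ (strict: associators and unitors are identities) such that, on the nose, $A\otimes(B\oplus C)=(A\otimes B)\oplus(A\otimes C)$ (also on morphisms), $N\otimes A=N=A\otimes N$, together with a natural isomorphism $\delta^\sharp:(A\otimes C)\oplus(B\otimes C)\to(A\oplus B)\otimes C$, satisfying Laplaza's coherence conditions for rig categories. A strict bipermutative functor $F$ preserves all of this on the nose: $F(N)=N$, $F(I)=I$, $F(A\otimes B)=FA\otimes FB$, $F(A\oplus B)=FA\oplus FB$ (also on morphisms), $F(\gamma_{A,B})=\gamma_{FA,FB}$, $F(\gamma'_{A,B})=\gamma'_{FA,FB}$. $\mathbf{Unitary}$: objects are natural numbers $n\ge 0$; morphisms $n\to n$ are $n\times n$ complex unitary matrices (no morphisms $m\to n$ for $m\neq n$); composition is matrix multiplication; $m\oplus n=m+n$ and $U\oplus V$ is the block diagonal matrix $\begin{pmatrix}U&0\\0&V\end{pmatrix}$, $N=0$; $m\otimes n=mn$ and $U\otimes V$ is the Kronecker product, $(U\otimes V)_{in+k,jn+l}=U_{i,j}V_{k,l}$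 for $V$ of size $n$, $I=1$; $\gamma$ and $\gamma'$ are the evident permutation matrices ($\gamma_{m,n}$ swaps the two blocks of $m+n$, $\gamma'_{m,n}$ is the permutation with $x\otimes y\mapsto y\otimes x$). $\mathbf{Isometry}$ is defined in the same way, except that morphisms $m\to n$ are the $n\times m$ complex matrices $V$ with $V^*V=I_m$ (so $m\le n$); here $N=0$ is initial, via the empty matrices $\text{!`}_n:0\to n$.
   Formalization: The Kronecker product is taken with the mirrored index order, (U⊗V)_{kp+i,lq+j}=U_{ij}V_{kl} for U of size p×q, since the stated formula violates the required strict A⊗(B⊕C)=(A⊗B)⊕(A⊗C) on morphisms; γ' is adjusted accordingly. *)

theory Defs
  imports Complex_Main "Jordan_Normal_Form.Matrix"
begin

text \<open>A (small or large) category is given by a set of objects, a set of arrows,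
domain, codomain, composition (Cmp g f = g after f) and identities.
The remaining fields carry the bipermutative structure:
(PlO, PlM, Nul, Gam) = (oplus on objects, oplus on arrows, N, gamma),
(TmO, TmM, Unt, GamT) = (otimes on objects, otimes on arrows, I, gamma'),
Dsh a b c = delta-sharp : (a otimes c) oplus (b otimes c) -> (a oplus b) otimes c.\<close>

record ('o,'m) bipcat =
  Obj  :: "'o set"
  Arr  :: "'m set"
  Dom  :: "'m \<Rightarrow> 'o"
  Cod  :: "'m \<Rightarrow> 'o"
  Cmp  :: "'m \<Rightarrow> 'm \<Rightarrow> 'm"
  Idm  :: "'o \<Rightarrow> 'm"
  PlO  :: "'o \<Rightarrow> 'o \<Rightarrow> 'o"
  PlM  :: "'m \<Rightarrow> 'm \<Rightarrow> 'm"
  Nul  :: "'o"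
  Gam  :: "'o \<Rightarrow> 'o \<Rightarrow> 'm"
  TmO  :: "'o \<Rightarrow> 'o \<Rightarrow> 'o"
  TmM  :: "'m \<Rightarrow> 'm \<Rightarrow> 'm"
  Unt  :: "'o"
  GamT :: "'o \<Rightarrow> 'o \<Rightarrow> 'm"
  Dsh  :: "'o \<Rightarrow> 'o \<Rightarrow> 'o \<Rightarrow> 'm"

definition hom :: "('o,'m,'x) bipcat_scheme \<Rightarrow> 'o \<Rightarrow> 'o \<Rightarrow> 'm set" where
  "hom C a b = {f \<in> Arr C. Dom C f = a \<and> Cod C f = b}"

definition is_category :: "('o,'m,'x) bipcat_scheme \<Rightarrow> bool" where
  "is_category C \<longleftrightarrow>
     (\<forall>f\<in>Arr C. Dom C f \<in> Obj C \<and> Cod C f \<in> Obj C) \<and>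
     (\<forall>a\<in>Obj C. Idm C a \<in> hom C a a) \<and>
     (\<forall>f\<in>Arr C. \<forall>g\<in>Arr C. Cod C f = Dom C g \<longrightarrow>
         Cmp C g f \<in> hom C (Dom C f) (Cod C g)) \<and>
     (\<forall>f\<in>Arr C. Cmp C (Idm C (Cod C f)) f = f \<and> Cmp C f (Idm C (Dom C f)) = f) \<and>
     (\<forall>f\<in>Arr C. \<forall>g\<in>Arr C. \<forall>h\<in>Arr C. Cod C f = Dom C g \<and> Cod C g = Dom C h \<longrightarrow>
         Cmp C h (Cmp C g f) = Cmp C (Cmp C h g) f)"

definition is_iso :: "('o,'m,'x) bipcat_scheme \<Rightarrow> 'm \<Rightarrow> bool" where
  "is_iso C f \<longleftrightarrow> f \<in> Arr C \<and> (\<exists>g\<in>hom C (Cod C f) (Dom C f).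
      Cmp C g f = Idm C (Dom C f) \<and> Cmp C f g = Idm C (Cod C f))"

definition initial_obj :: "('o,'m,'x) bipcat_scheme \<Rightarrow> 'o \<Rightarrow> bool" where
  "initial_obj C z \<longleftrightarrow> z \<in> Obj C \<and> (\<forall>a\<in>Obj C. \<exists>!f. f \<in> hom C z a)"

definition permutative :: "('o,'m,'x) bipcat_scheme \<Rightarrow> ('o \<Rightarrow> 'o \<Rightarrow> 'o) \<Rightarrow>
    ('m \<Rightarrow> 'm \<Rightarrow> 'm) \<Rightarrow> 'o \<Rightarrow> ('o \<Rightarrow> 'o \<Rightarrow> 'm) \<Rightarrow> bool" where
  "permutative C PO PM E G \<longleftrightarrow>
     E \<in> Obj C \<and>
     (\<forall>a\<in>Obj C. \<forall>b\<in>Obj C. PO a b \<in> Obj C) \<and>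
     (\<forall>f\<in>Arr C. \<forall>g\<in>Arr C.
         PM f g \<in> hom C (PO (Dom C f) (Dom C g)) (PO (Cod C f) (Cod C g))) \<and>
     (\<forall>a\<in>Obj C. \<forall>b\<in>Obj C. PM (Idm C a) (Idm C b) = Idm C (PO a b)) \<and>
     (\<forall>f\<in>Arr C. \<forall>g\<in>Arr C. \<forall>f'\<in>Arr C. \<forall>g'\<in>Arr C.
         Cod C f = Dom C g \<and> Cod C f' = Dom C g' \<longrightarrow>
         PM (Cmp C g f) (Cmp C g' f') = Cmp C (PM g g') (PM f f')) \<and>
     (\<forall>a\<in>Obj C. PO E a = a \<and> PO a E = a) \<and>
     (\<forall>f\<in>Arr C. PM (Idm C E) f = f \<and> PM f (Idm C E) = f) \<and>
     (\<forall>a\<in>Obj C. \<forall>b\<in>Obj C. \<forall>c\<in>Obj C. PO (PO a b) c = PO a (PO b c)) \<and>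
     (\<forall>f\<in>Arr C. \<forall>g\<in>Arr C. \<forall>h\<in>Arr C. PM (PM f g) h = PM f (PM g h)) \<and>
     (\<forall>a\<in>Obj C. \<forall>b\<in>Obj C. G a b \<in> hom C (PO a b) (PO b a)) \<and>
     (\<forall>f\<in>Arr C. \<forall>g\<in>Arr C.
         Cmp C (G (Cod C f) (Cod C g)) (PM f g) = Cmp C (PM g f) (G (Dom C f) (Dom C g))) \<and>
     (\<forall>a\<in>Obj C. \<forall>b\<in>Obj C. Cmp C (G b a) (G a b) = Idm C (PO a b)) \<and>
     (\<forall>a\<in>Obj C. G a E = Idm C a) \<and>
     (\<forall>a\<in>Obj C. \<forall>b\<in>Obj C. \<forall>c\<in>Obj C.
         G a (PO b c) = Cmp C (PM (Idm C b) (G a c)) (PM (G a b) (Idm C c)))"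

text \<open>Bipermutative category: two permutative structures, strict left distributivity,
strict annihilation by N, and a natural isomorphism delta-sharp satisfying
Laplaza's coherence conditions in their strict form (all associators, unitors,
annihilators and the left distributor being identities).\<close>

definition bipermutative :: "('o,'m,'x) bipcat_scheme \<Rightarrow> bool" where
  "bipermutative C \<longleftrightarrow>
     is_category C \<and>
     permutative C (PlO C) (PlM C) (Nul C) (Gam C) \<and>
     permutative C (TmO C) (TmM C) (Unt C) (GamT C) \<and>
     \<comment> \<open>strict left distributivity, on objects and on arrows\<close>
     (\<forall>a\<in>Obj C. \<forall>b\<in>Obj C. \<forall>c\<in>Obj C.
         TmO C a (PlO C b c) = PlO C (TmO C a b) (TmO C a c)) \<and>
     (\<forall>f\<in>Arr C. \<forall>g\<in>Arr C. \<forall>h\<in>Arr C.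
         TmM C f (PlM C g h) = PlM C (TmM C f g) (TmM C f h)) \<and>
     \<comment> \<open>strict annihilation by N (objects; arrows = naturality of the identity annihilators)\<close>
     (\<forall>a\<in>Obj C. TmO C (Nul C) a = Nul C \<and> TmO C a (Nul C) = Nul C) \<and>
     (\<forall>f\<in>Arr C. TmM C (Idm C (Nul C)) f = Idm C (Nul C) \<and> TmM C f (Idm C (Nul C)) = Idm C (Nul C)) \<and>
     \<comment> \<open>delta-sharp is a natural isomorphism\<close>
     (\<forall>a\<in>Obj C. \<forall>b\<in>Obj C. \<forall>c\<in>Obj C.
         Dsh C a b c \<in> hom C (PlO C (TmO C a c) (TmO C b c)) (TmO C (PlO C a b) c)
         \<and> is_iso C (Dsh C a b c)) \<and>
     (\<forall>f\<in>Arr C. \<forall>g\<in>Arr C. \<forall>h\<in>Arr C.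
         Cmp C (Dsh C (Cod C f) (Cod C g) (Cod C h)) (PlM C (TmM C f h) (TmM C g h)) =
         Cmp C (TmM C (PlM C f g) h) (Dsh C (Dom C f) (Dom C g) (Dom C h))) \<and>
     \<comment> \<open>Laplaza's coherence conditions (strict form)\<close>
     (\<forall>a\<in>Obj C. \<forall>b\<in>Obj C. \<forall>c\<in>Obj C.
         TmM C (Idm C a) (Gam C b c) = Gam C (TmO C a b) (TmO C a c)) \<and>
     (\<forall>a\<in>Obj C. \<forall>b\<in>Obj C. \<forall>c\<in>Obj C.
         Cmp C (Dsh C b a c) (Gam C (TmO C a c) (TmO C b c)) =
         Cmp C (TmM C (Gam C a b) (Idm C c)) (Dsh C a b c)) \<and>
     (\<forall>a\<in>Obj C. \<forall>b\<in>Obj C. \<forall>c\<in>Obj C. \<forall>d\<in>Obj C.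
         Cmp C (Dsh C (PlO C a b) c d) (PlM C (Dsh C a b d) (Idm C (TmO C c d))) =
         Cmp C (Dsh C a (PlO C b c) d) (PlM C (Idm C (TmO C a d)) (Dsh C b c d))) \<and>
     (\<forall>a\<in>Obj C. \<forall>b\<in>Obj C. \<forall>c\<in>Obj C. \<forall>d\<in>Obj C.
         Dsh C a b (TmO C c d) =
         Cmp C (TmM C (Dsh C a b c) (Idm C d)) (Dsh C (TmO C a c) (TmO C b c) d)) \<and>
     (\<forall>a\<in>Obj C. \<forall>b\<in>Obj C. \<forall>c\<in>Obj C. \<forall>d\<in>Obj C.
         TmM C (Idm C a) (Dsh C b c d) = Dsh C (TmO C a b) (TmO C a c) d) \<and>
     (\<forall>a\<in>Obj C. \<forall>b\<in>Obj C. \<forall>c\<in>Obj C. \<forall>d\<in>Obj C.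
         Cmp C (Dsh C a b (PlO C c d))
           (PlM C (Idm C (TmO C a c))
              (PlM C (Gam C (TmO C b c) (TmO C a d)) (Idm C (TmO C b d)))) =
         PlM C (Dsh C a b c) (Dsh C a b d)) \<and>
     (\<forall>a\<in>Obj C. \<forall>b\<in>Obj C. \<forall>c\<in>Obj C.
         Dsh C a b (Unt C) = Idm C (PlO C a b) \<and>
         Dsh C (Nul C) b c = Idm C (TmO C b c) \<and>
         Dsh C a (Nul C) c = Idm C (TmO C a c) \<and>
         Dsh C a b (Nul C) = Idm C (Nul C)) \<and>
     (\<forall>a\<in>Obj C. \<forall>b\<in>Obj C. \<forall>c\<in>Obj C.
         Cmp C (GamT C (PlO C a b) c) (Dsh C a b c) = PlM C (GamT C a c) (GamT C b c)) \<and>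
     (\<forall>a\<in>Obj C. GamT C (Nul C) a = Idm C (Nul C) \<and> GamT C a (Nul C) = Idm C (Nul C))"

definition strict_bip_functor :: "('o,'m,'x) bipcat_scheme \<Rightarrow> ('p,'n,'y) bipcat_scheme \<Rightarrow>
    ('o \<Rightarrow> 'p) \<Rightarrow> ('m \<Rightarrow> 'n) \<Rightarrow> bool" where
  "strict_bip_functor C D Fo Fm \<longleftrightarrow>
     (\<forall>a\<in>Obj C. Fo a \<in> Obj D) \<and>
     (\<forall>f\<in>Arr C. Fm f \<in> hom D (Fo (Dom C f)) (Fo (Cod C f))) \<and>
     (\<forall>a\<in>Obj C. Fm (Idm C a) = Idm D (Fo a)) \<and>
     (\<forall>f\<in>Arr C. \<forall>g\<in>Arr C. Cod C f = Dom C g \<longrightarrow> Fm (Cmp C g f) = Cmp D (Fm g) (Fm f)) \<and>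
     Fo (Nul C) = Nul D \<and> Fo (Unt C) = Unt D \<and>
     (\<forall>a\<in>Obj C. \<forall>b\<in>Obj C. Fo (PlO C a b) = PlO D (Fo a) (Fo b) \<and>
                            Fo (TmO C a b) = TmO D (Fo a) (Fo b)) \<and>
     (\<forall>f\<in>Arr C. \<forall>g\<in>Arr C. Fm (PlM C f g) = PlM D (Fm f) (Fm g) \<and>
                            Fm (TmM C f g) = TmM D (Fm f) (Fm g)) \<and>
     (\<forall>a\<in>Obj C. \<forall>b\<in>Obj C. Fm (Gam C a b) = Gam D (Fo a) (Fo b) \<and>
                            Fm (GamT C a b) = GamT D (Fo a) (Fo b))"

definition cadj :: "complex mat \<Rightarrow> complex mat" where
  "cadj A = mat (dim_col A) (dim_row A) (\<lambda>(i,j). cnj (A $$ (j,i)))"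

definition dsum :: "complex mat \<Rightarrow> complex mat \<Rightarrow> complex mat" where
  "dsum A B = four_block_mat A (0\<^sub>m (dim_row A) (dim_col B)) (0\<^sub>m (dim_row B) (dim_col A)) B"

definition kron :: "complex mat \<Rightarrow> complex mat \<Rightarrow> complex mat" where
  "kron A B = mat (dim_row A * dim_row B) (dim_col A * dim_col B)
     (\<lambda>(r,s). A $$ (r mod dim_row A, s mod dim_col A) * B $$ (r div dim_row A, s div dim_col A))"

definition permmat :: "nat \<Rightarrow> (nat \<Rightarrow> nat) \<Rightarrow> complex mat" where
  "permmat n s = mat n n (\<lambda>(i,j). if i = s j then 1 else 0)"

definition swapP :: "nat \<Rightarrow> nat \<Rightarrow> complex mat" where
  "swapP m n = permmat (m + n) (\<lambda>j. if j < m then n + j else j - m)"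

definition swapT :: "nat \<Rightarrow> nat \<Rightarrow> complex mat" where
  "swapT m n = permmat (m * n) (\<lambda>j. (j mod m) * n + j div m)"

definition dshP :: "nat \<Rightarrow> nat \<Rightarrow> nat \<Rightarrow> complex mat" where
  "dshP a b c = permmat ((a + b) * c)
     (\<lambda>j. if j < a * c then (j div a) * (a + b) + j mod a
          else ((j - a * c) div b) * (a + b) + a + (j - a * c) mod b)"

definition unitary_cat :: "(nat, complex mat) bipcat" where
  "unitary_cat = \<lparr> Obj = UNIV,
     Arr = {U. dim_row U = dim_col U \<and> cadj U * U = 1\<^sub>m (dim_col U) \<and> U * cadj U = 1\<^sub>m (dim_row U)},
     Dom = dim_col, Cod = dim_row, Cmp = (\<lambda>g f. g * f), Idm = (\<lambda>n. 1\<^sub>m n),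
     PlO = (+), PlM = dsum, Nul = 0, Gam = swapP,
     TmO = (*), TmM = kron, Unt = 1, GamT = swapT, Dsh = dshP \<rparr>"

definition isometry_cat :: "(nat, complex mat) bipcat" where
  "isometry_cat = \<lparr> Obj = UNIV,
     Arr = {V. cadj V * V = 1\<^sub>m (dim_col V)},
     Dom = dim_col, Cod = dim_row, Cmp = (\<lambda>g f. g * f), Idm = (\<lambda>n. 1\<^sub>m n),
     PlO = (+), PlM = dsum, Nul = 0, Gam = swapP,
     TmO = (*), TmM = kron, Unt = 1, GamT = swapT, Dsh = dshP \<rparr>"

definition J_obj :: "nat \<Rightarrow> nat" where "J_obj = id"
definition J_mor :: "complex mat \<Rightarrow> complex mat" where "J_mor = id"

end

(* An isometry V from m to n = m + k is the composite of the inclusion 1 \<oplus> ! from m + 0 to m + k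
   with some unitary U, and U is unique up to right multiplication by a matrix 1 \<oplus> W with W
   unitary of size k. Hence F-hat V = F U o (1 \<oplus> !) is forced, and it is well defined because
   F W o ! = ! by initiality of the additive unit. A composite, sum or tensor product of two arrows
   U o (1 \<oplus> !) is brought back to that form by an explicit unitary built from symmetries and
   distributors. This calculation is valid in every bipermutative category with initial additive
   unit, in particular in Isometry itself, so both sides of each functoriality equation are
   represented by the same unitary. The distributor need not be assumed to be preserved, as
   Laplaza's axioms express it through the multiplicative symmetry. *)
theory Submission
  imports Defs
begin

text \<open>The existence of \<open>U\<close> rests on one trace computation. For an isometry
  \<open>V\<close> with \<open>n\<close> rows and \<open>m\<close> columns, the projection
  \<open>Q = 1 - V * cadj V\<close> has trace \<open>n - m\<close>, and as
  \<open>cadj Q * Q = Q\<close>, this trace is the sum of the squared moduli of the entries of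
  \<open>Q\<close>. Hence m \<le> n, a square isometry is unitary, and for m < n some column of
  \<open>Q\<close> is nonzero and can be adjoined to \<open>V\<close>. The ambiguity of
  \<open>U\<close> comes from block structure: if \<open>U\<close> and \<open>U'\<close> complete
  the same isometry, then \<open>cadj U * U'\<close> and its adjoint both fix the first
  \<open>m\<close> basis vectors, so nothing but a block on the last \<open>k\<close> coordinates is
  free. In a sum or product of two inclusions the coordinates outside the image are scattered among
  the others. The correcting unitary gathers them at the end: for sums it exchanges the two middle
  summands, for products it is a distributor. Since the structure is strict, the bipermutative
  axioms for matrices are literal equations between permutation matrices. They become arithmetic of
  indices i + a * k, avoided where a multiplicative symmetry can be cancelled.\<close>

section \<open>Direct sums, Kronecker products and permutation matrices\<close>

text \<open>In \<open>kron A B\<close> the row pair \<open>(i,k)\<close> has index \<open>i + dim_row A * k\<close>: the first factor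
  varies fastest, which is what makes left distributivity strict.\<close>

lemma pair_index_less: "i + a * k < a * b" if "i < a" "k < b" for a b i k :: nat
proof -
  have "i + a * k < a * Suc k" using that by simp
  also have "a * Suc k \<le> a * b" using that by (intro mult_le_mono2) simp
  finally show ?thesis .
qed

lemma pair_index_cases:
  fixes j :: nat
  assumes "j < a * b"
  obtains i k where "i < a" "k < b" "j = i + a * k"
proof
  have "a \<noteq> 0" using assms by (cases a) auto
  then show "j mod a < a" by simp
  show "j div a < b" using assms by (simp add: less_mult_imp_div_less mult.commute)
  show "j = j mod a + a * (j div a)" by simp
qed

lemma pair_index_mod [simp]: "i < a \<Longrightarrow> (i + a * k) mod a = i" for a i k :: nat
  by simp

lemma pair_index_div [simp]: "i < a \<Longrightarrow> (i + a * k) div a = k" for a i k :: nat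
  by simp

lemma sum_pair_index:
  fixes f :: "nat \<Rightarrow> 'a::comm_monoid_add"
  shows "(\<Sum>t<a * b. f t) = (\<Sum>k<b. \<Sum>i<a. f (i + a * k))"
proof -
  have "(\<Sum>t<a * b. f t) = (\<Sum>(k,i)\<in>{..<b} \<times> {..<a}. f (i + a * k))"
    by (rule sum.reindex_bij_witness[where i = "\<lambda>(k,i). i + a * k" and j = "\<lambda>t. (t div a, t mod a)"])
       (auto simp: pair_index_less elim: pair_index_cases)
  then show ?thesis by (simp add: sum.cartesian_product)
qed

section \<open>Dimensions, entries and algebra of the matrix operations\<close>

lemma dim_dsum [simp]:
  "dim_row (dsum A B) = dim_row A + dim_row B" "dim_col (dsum A B) = dim_col A + dim_col B"
  by (simp_all add: dsum_def)

lemma dim_kron [simp]: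
  "dim_row (kron A B) = dim_row A * dim_row B" "dim_col (kron A B) = dim_col A * dim_col B"
  by (simp_all add: kron_def)

lemma dim_cadj [simp]: "dim_row (cadj A) = dim_col A" "dim_col (cadj A) = dim_row A"
  by (simp_all add: cadj_def)

lemma dim_permmat [simp]: "dim_row (permmat n s) = n" "dim_col (permmat n s) = n"
  by (simp_all add: permmat_def)

lemma index_cadj [simp]: "i < dim_col A \<Longrightarrow> j < dim_row A \<Longrightarrow> cadj A $$ (i,j) = cnj (A $$ (j,i))"
  by (simp add: cadj_def)

lemma index_permmat [simp]: "i < n \<Longrightarrow> j < n \<Longrightarrow> permmat n s $$ (i,j) = (if i = s j then 1 else 0)"
  by (simp add: permmat_def)

lemma index_dsum [simp]:
  "i < dim_row A + dim_row B \<Longrightarrow> j < dim_col A + dim_col B \<Longrightarrow> dsum A B $$ (i,j) =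
     (if i < dim_row A then if j < dim_col A then A $$ (i,j) else 0
      else if j < dim_col A then 0 else B $$ (i - dim_row A, j - dim_col A))"
  unfolding dsum_def by (subst index_mat_four_block) auto

lemma index_kron [simp]:
  "i < dim_row A * dim_row B \<Longrightarrow> j < dim_col A * dim_col B \<Longrightarrow> kron A B $$ (i,j) =
     A $$ (i mod dim_row A, j mod dim_col A) * B $$ (i div dim_row A, j div dim_col A)"
  by (simp add: kron_def)

lemma index_kron_pair [simp]:
  assumes "i < dim_row A" "k < dim_row B" "j < dim_col A" "l < dim_col B"
  shows "kron A B $$ (i + dim_row A * k, j + dim_col A * l) = A $$ (i,j) * B $$ (k,l)"
  using assms by (simp add: pair_index_less)

lemma index_mult_sum:
  "i < dim_row A \<Longrightarrow> j < dim_col B \<Longrightarrow> dim_col A = dim_row B \<Longrightarrow>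
     (A * B) $$ (i,j) = (\<Sum>t<dim_row B. A $$ (i,t) * B $$ (t,j))"
  by (simp add: scalar_prod_def lessThan_atLeast0)

text \<open>The default rule turns an entry of a product into a scalar product of a row and a
  column. Without it entries are opened only on demand, as a sum or by the rules for permutation
  matrices.\<close>

declare index_mult_mat(1) [simp del]

lemma mat_mult_assoc:
  "dim_col A = dim_row B \<Longrightarrow> dim_col B = dim_row C \<Longrightarrow> A * B * C = A * (B * C)"
  by (rule assoc_mult_mat) (auto intro: carrier_matI)

lemma mat_one_left [simp]: "n = dim_row (A :: 'a::semiring_1 mat) \<Longrightarrow> 1\<^sub>m n * A = A"
  by (rule left_mult_one_mat[of _ _ "dim_col A"]) auto

lemma mat_one_right [simp]: "n = dim_col (A :: 'a::semiring_1 mat) \<Longrightarrow> A * 1\<^sub>m n = A"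
  by (rule right_mult_one_mat[of _ "dim_row A"]) auto

lemma cadj_cadj [simp]: "cadj (cadj A) = A"
  by (rule eq_matI) auto

lemma cadj_one [simp]: "cadj (1\<^sub>m n) = 1\<^sub>m n"
  by (rule eq_matI) auto

lemma cadj_mult: "dim_col A = dim_row B \<Longrightarrow> cadj (A * B) = cadj B * cadj A"
  by (rule eq_matI) (auto simp: index_mult_sum mult.commute intro!: sum.cong)

lemma cadj_dsum: "cadj (dsum A B) = dsum (cadj A) (cadj B)"
  by (rule eq_matI) (auto split: if_splits)

lemma mod_less_left: "i < a * b \<Longrightarrow> i mod a < a" for i a b :: nat
  by (cases a) auto

lemma div_less_right: "i < a * b \<Longrightarrow> i div a < b" for i a b :: nat
  by (simp add: less_mult_imp_div_less mult.commute)

lemma cadj_kron: "cadj (kron A B) = kron (cadj A) (cadj B)"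
  by (rule eq_matI) (auto simp: mod_less_left div_less_right)

lemma dsum_mult:
  assumes "dim_col A = dim_row C" "dim_col B = dim_row D"
  shows "dsum A B * dsum C D = dsum (A * C) (B * D)"
proof -
  have "dsum A B * dsum C D = four_block_mat
      (A * C + 0\<^sub>m (dim_row A) (dim_col B) * 0\<^sub>m (dim_row D) (dim_col C))
      (A * 0\<^sub>m (dim_row C) (dim_col D) + 0\<^sub>m (dim_row A) (dim_col B) * D)
      (0\<^sub>m (dim_row B) (dim_col A) * C + B * 0\<^sub>m (dim_row D) (dim_col C))
      (0\<^sub>m (dim_row B) (dim_col A) * 0\<^sub>m (dim_row C) (dim_col D) + B * D)"
    unfolding dsum_def using assms by (intro mult_four_block_mat) (auto intro: carrier_matI)
  also have "\<dots> = dsum (A * C) (B * D)"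
    unfolding dsum_def using assms
    by (intro cong_four_block_mat) (auto intro!: eq_matI)
  finally show ?thesis .
qed

text \<open>The summation index of the product is a pair, so the sum splits by
  \<open>sum_pair_index\<close> and factors into the two ordinary matrix products.\<close>

lemma kron_mult:
  assumes "dim_col A = dim_row C" "dim_col B = dim_row D"
  shows "kron A B * kron C D = kron (A * C) (B * D)"
proof (rule eq_matI)
  fix i j assume ij: "i < dim_row (kron (A * C) (B * D))" "j < dim_col (kron (A * C) (B * D))"
  have i: "i < dim_row A * dim_row B" and j: "j < dim_col C * dim_col D" using ij by auto
  have "(kron A B * kron C D) $$ (i,j) =
      (\<Sum>t<dim_row C * dim_row D. kron A B $$ (i,t) * kron C D $$ (t,j))"
    using ij assms by (subst index_mult_sum) auto
  also have "\<dots> = (\<Sum>l<dim_row D. \<Sum>k<dim_row C.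
      kron A B $$ (i, k + dim_row C * l) * kron C D $$ (k + dim_row C * l, j))"
    by (rule sum_pair_index)
  also have "\<dots> = (\<Sum>l<dim_row D. \<Sum>k<dim_row C.
      (A $$ (i mod dim_row A, k) * C $$ (k, j mod dim_col C)) *
      (B $$ (i div dim_row A, l) * D $$ (l, j div dim_col C)))"
    using i j assms by (intro sum.cong refl) (simp add: pair_index_less)
  also have "\<dots> = (A * C) $$ (i mod dim_row A, j mod dim_col C) * (B * D) $$ (i div dim_row A, j div dim_col C)"
    using i j assms by (simp add: index_mult_sum mod_less_left div_less_right sum_product sum.swap[of _ "{..<dim_row D}"])
  also have "\<dots> = kron (A * C) (B * D) $$ (i,j)" using i j by simp
  finally show "(kron A B * kron C D) $$ (i,j) = kron (A * C) (B * D) $$ (i,j)" .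
qed auto

lemma dsum_one_one [simp]: "dsum (1\<^sub>m m) (1\<^sub>m n) = 1\<^sub>m (m + n)"
  by (rule eq_matI) auto

lemma pair_index_eq_iff: "i mod a = j mod a \<and> i div a = j div a \<longleftrightarrow> i = j" for i j a :: nat
  by (metis div_mult_mod_eq)

lemma kron_one_one [simp]: "kron (1\<^sub>m m) (1\<^sub>m n) = 1\<^sub>m (m * n)"
  by (rule eq_matI) (use pair_index_eq_iff in \<open>auto simp: mod_less_left div_less_right\<close>)

lemma dsum_one_0 [simp]: "dsum (1\<^sub>m 0) A = A" "dsum A (1\<^sub>m 0) = A"
  by (rule eq_matI; auto)+

lemma kron_one_1 [simp]: "kron (1\<^sub>m (Suc 0)) A = A" "kron A (1\<^sub>m (Suc 0)) = A"
  by (rule eq_matI; auto)+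

lemma kron_one_0 [simp]: "kron (1\<^sub>m 0) A = 1\<^sub>m 0" "kron A (1\<^sub>m 0) = 1\<^sub>m 0"
  by (rule eq_matI; auto)+

lemma dsum_assoc: "dsum (dsum A B) C = dsum A (dsum B C)"
proof (rule eq_matI)
  fix i j assume "i < dim_row (dsum A (dsum B C))" "j < dim_col (dsum A (dsum B C))"
  then have ij: "i < dim_row A + dim_row B + dim_row C" "j < dim_col A + dim_col B + dim_col C"
    by auto
  show "dsum (dsum A B) C $$ (i,j) = dsum A (dsum B C) $$ (i,j)"
    using ij
    by (cases "i < dim_row A"; cases "i < dim_row A + dim_row B";
        cases "j < dim_col A"; cases "j < dim_col A + dim_col B") (simp_all add: less_diff_conv2)
qed auto

lemma kron_assoc: "kron (kron A B) C = kron A (kron B C)"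
proof (rule eq_matI)
  fix i j assume "i < dim_row (kron A (kron B C))" "j < dim_col (kron A (kron B C))"
  then have ij: "i < dim_row A * (dim_row B * dim_row C)" "j < dim_col A * (dim_col B * dim_col C)"
    by auto
  then have ij': "i < dim_row A * dim_row B * dim_row C" "j < dim_col A * dim_col B * dim_col C"
    by (auto simp: mult.assoc)
  \<comment> \<open>The middle digit of a three-digit mixed-radix index does not depend on which two
    digits are read together first.\<close>
  have *: "r mod (a * b) div a = r div a mod b" for r a b :: nat
    by (cases "a = 0") (simp_all add: mod_mult2_eq)
  show "kron (kron A B) C $$ (i,j) = kron A (kron B C) $$ (i,j)"
    using ij ij' mod_less_left[OF ij'(1)] mod_less_left[OF ij'(2)] div_less_right[OF ij(1)] div_less_right[OF ij(2)]
    by (simp add: div_mult2_eq mod_mod_cancel *)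
qed auto

text \<open>With the first factor varying fastest, the pairs whose second entry lies below
  \<open>b\<close> fill the initial segment of length a * b. Splitting the second factor thus splits
  the index range into two blocks, which makes left distributivity strict.\<close>

lemma pair_index_sum_cases:
  fixes j :: nat
  assumes "j < a * (b + c)"
  obtains (left) i k where "i < a" "k < b" "j = i + a * k"
    | (right) i k where "i < a" "k < c" "j = a * b + (i + a * k)"
proof -
  obtain i k where *: "i < a" "k < b + c" "j = i + a * k" using assms by (rule pair_index_cases)
  show thesis
  proof (cases "k < b")
    case True
    then show thesis using * left by blast
  next
    case False
    then obtain l where "k = b + l" using le_Suc_ex by (metis not_less)
    then show thesis using * right[of i l] by (simp add: algebra_simps)
  qed
qed

lemma right_pair_index: "a * b + (i + a * k) = i + a * (b + k)" for a b i k :: nat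
  by (simp add: algebra_simps)

lemma right_pair_index_mod [simp]: "i < a \<Longrightarrow> (a * b + (i + a * k)) mod a = i" for a b i k :: nat
  by (subst right_pair_index) (rule pair_index_mod)

lemma right_pair_index_div [simp]: "i < a \<Longrightarrow> (a * b + (i + a * k)) div a = b + k" for a b i k :: nat
  by (subst right_pair_index) (rule pair_index_div)

lemma kron_dsum_distrib: "kron A (dsum B C) = dsum (kron A B) (kron A C)"
proof (rule eq_matI)
  fix i j assume "i < dim_row (dsum (kron A B) (kron A C))" "j < dim_col (dsum (kron A B) (kron A C))"
  then have ij: "i < dim_row A * (dim_row B + dim_row C)" "j < dim_col A * (dim_col B + dim_col C)"
    by (auto simp: algebra_simps)
  have lhs: "kron A (dsum B C) $$ (i,j) = A $$ (i mod dim_row A, j mod dim_col A) *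
      dsum B C $$ (i div dim_row A, j div dim_col A)"
    using ij by simp
  have rhs: "dsum (kron A B) (kron A C) $$ (i,j) =
     (if i < dim_row A * dim_row B then if j < dim_col A * dim_col B then kron A B $$ (i,j) else 0
      else if j < dim_col A * dim_col B then 0
      else kron A C $$ (i - dim_row A * dim_row B, j - dim_col A * dim_col B))"
    using ij by (simp add: algebra_simps)
  show "kron A (dsum B C) $$ (i,j) = dsum (kron A B) (kron A C) $$ (i,j)"
    using ij(1)
  proof (cases rule: pair_index_sum_cases)
    case l: (left i' k)
    show ?thesis unfolding lhs rhs using ij(2)
      by (cases rule: pair_index_sum_cases) (use l in \<open>simp_all add: pair_index_less\<close>)
  next
    case r: (right i' k)
    show ?thesis unfolding lhs rhs using ij(2)
      by (cases rule: pair_index_sum_cases) (use r in \<open>simp_all add: pair_index_less\<close>)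
  qed
qed (auto simp: algebra_simps)

subsection \<open>Permutation matrices\<close>

lemma permmat_cong: "(\<And>j. j < n \<Longrightarrow> s j = t j) \<Longrightarrow> permmat n s = permmat n t"
  by (rule eq_matI) auto

lemma permmat_id: "(\<And>j. j < n \<Longrightarrow> s j = j) \<Longrightarrow> permmat n s = 1\<^sub>m n"
  by (rule eq_matI) auto

text \<open>Column \<open>j\<close> of \<open>permmat n t\<close> is the basis vector with index
  \<open>t j\<close>, so multiplication on the right selects columns.\<close>

lemma index_mult_permmat:
  assumes "dim_col A = n" "i < dim_row A" "j < n" "t j < n"
  shows "(A * permmat n t) $$ (i,j) = A $$ (i, t j)"
proof -
  have "(A * permmat n t) $$ (i,j) = (\<Sum>k<n. A $$ (i,k) * (if k = t j then 1 else 0))"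
    using assms by (simp add: index_mult_sum)
  also have "\<dots> = (\<Sum>k<n. if k = t j then A $$ (i,k) else 0)" by (intro sum.cong) auto
  also have "\<dots> = A $$ (i, t j)" using assms by simp
  finally show ?thesis .
qed

text \<open>Multiplication on the left moves row \<open>i\<close> to row \<open>s i\<close>.
  Evaluating at \<open>s i\<close> avoids any mention of the inverse permutation.\<close>

lemma index_permmat_mult:
  assumes "dim_row A = n" "i < n" "s i < n" "inj_on s {..<n}" "j < dim_col A"
  shows "(permmat n s * A) $$ (s i,j) = A $$ (i, j)"
proof -
  have "(permmat n s * A) $$ (s i,j) = (\<Sum>k<n. (if s i = s k then 1 else 0) * A $$ (k,j))"
    using assms by (simp add: index_mult_sum)
  also have "\<dots> = (\<Sum>k<n. if k = i then A $$ (k,j) else 0)"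
    using assms by (intro sum.cong) (auto dest: inj_onD)
  also have "\<dots> = A $$ (i, j)" using assms by simp
  finally show ?thesis .
qed

lemma permmat_mult:
  assumes "\<And>j. j < n \<Longrightarrow> t j < n"
  shows "permmat n s * permmat n t = permmat n (s \<circ> t)"
  by (rule eq_matI) (use assms in \<open>auto simp: index_mult_permmat\<close>)

lemma bij_of_inj_less:
  fixes s :: "nat \<Rightarrow> nat"
  assumes "\<And>i. i < n \<Longrightarrow> s i < n" "inj_on s {..<n}"
  shows "bij_betw s {..<n} {..<n}"
proof -
  have "s ` {..<n} \<subseteq> {..<n}" using assms by auto
  then have "s ` {..<n} = {..<n}" using assms by (simp add: endo_inj_surj)
  then show ?thesis using assms by (simp add: bij_betw_def)
qed

text \<open>The common form of all naturality squares for symmetries and distributors: once the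
  permutations act on indices, a square is an equality of entries without any sum.\<close>

lemma permmat_intertwine:
  assumes s: "\<And>i. i < n \<Longrightarrow> s i < n" "inj_on s {..<n}"
    and t: "\<And>j. j < m \<Longrightarrow> t j < m"
    and dims: "dim_row A = n" "dim_col A = m" "dim_row B = n" "dim_col B = m"
    and eq: "\<And>i j. i < n \<Longrightarrow> j < m \<Longrightarrow> B $$ (s i, t j) = A $$ (i,j)"
  shows "permmat n s * A = B * permmat m t"
proof (rule eq_matI)
  fix i j assume "i < dim_row (B * permmat m t)" "j < dim_col (B * permmat m t)"
  then have i: "i < n" and j: "j < m" using dims by auto
  obtain i' where i': "i' < n" "i = s i'"
    using bij_betw_imp_surj_on[OF bij_of_inj_less[OF s]] i by blast
  show "(permmat n s * A) $$ (i,j) = (B * permmat m t) $$ (i,j)"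
    using i' i j s t dims eq by (simp add: index_permmat_mult index_mult_permmat)
qed (use dims in auto)

text \<open>The adjoint is the permutation matrix of the inverse \<open>t\<close> of
  \<open>s\<close>, which exists because an injective self-map of a finite set is bijective.\<close>

lemma permmat_unitary:
  assumes "\<And>i. i < n \<Longrightarrow> s i < n" "inj_on s {..<n}"
  shows "cadj (permmat n s) * permmat n s = 1\<^sub>m n" "permmat n s * cadj (permmat n s) = 1\<^sub>m n"
proof -
  show *: "cadj (permmat n s) * permmat n s = 1\<^sub>m n"
    by (rule eq_matI) (use assms in \<open>auto simp: index_mult_permmat dest: inj_onD\<close>)
  define t where "t = inv_into {..<n} s"
  have bij: "bij_betw s {..<n} {..<n}" using assms by (rule bij_of_inj_less)
  have t: "t j < n" "s (t j) = j" if "j < n" for j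
    using bij that unfolding t_def
    by (auto dest: bij_betw_inv_into bij_betwE intro: bij_betw_inv_into_right)
  have ts: "t (s j) = j" if "j < n" for j
    using assms that unfolding t_def by simp
  have "cadj (permmat n s) = permmat n t"
    by (rule eq_matI) (use t ts in auto)
  then show "permmat n s * cadj (permmat n s) = 1\<^sub>m n"
    using t by (simp add: permmat_mult permmat_id)
qed

lemma dsum_permmat:
  assumes "\<And>j. j < m \<Longrightarrow> s j < m"
  shows "dsum (permmat m s) (permmat n t) =
    permmat (m + n) (\<lambda>j. if j < m then s j else m + t (j - m))"
  by (rule eq_matI) (use assms in \<open>force+\<close>)

lemma kron_permmat:
  assumes "\<And>j. j < m \<Longrightarrow> s j < m" 
  shows "kron (permmat m s) (permmat n t) =
    permmat (m * n) (\<lambda>j. s (j mod m) + m * t (j div m))"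
proof (rule eq_matI)
  fix i j assume "i < dim_row (permmat (m * n) (\<lambda>j. s (j mod m) + m * t (j div m)))"
    "j < dim_col (permmat (m * n) (\<lambda>j. s (j mod m) + m * t (j div m)))"
  then have ij: "i < m * n" "j < m * n" by auto
  have "i = s (j mod m) + m * t (j div m) \<longleftrightarrow> i mod m = s (j mod m) \<and> i div m = t (j div m)"
    using assms[OF mod_less_left[OF ij(2)]] by (metis mod_mult_div_eq pair_index_div pair_index_mod)
  then show "kron (permmat m s) (permmat n t) $$ (i,j) =
      permmat (m * n) (\<lambda>j. s (j mod m) + m * t (j div m)) $$ (i,j)"
    using ij by (auto simp: mod_less_left div_less_right)
qed auto

text \<open>The index maps inside \<open>swapP\<close>, \<open>swapT\<close> and \<open>dshP\<close>
  receive names so that they can be simplified on decoded indices, where \<open>div\<close> and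
  \<open>mod\<close> disappear.\<close>

definition swapP_idx :: "nat \<Rightarrow> nat \<Rightarrow> nat \<Rightarrow> nat" where
  "swapP_idx m n j = (if j < m then n + j else j - m)"

definition swapT_idx :: "nat \<Rightarrow> nat \<Rightarrow> nat \<Rightarrow> nat" where
  "swapT_idx m n j = (j mod m) * n + j div m"

definition dshP_idx :: "nat \<Rightarrow> nat \<Rightarrow> nat \<Rightarrow> nat \<Rightarrow> nat" where
  "dshP_idx a b c j = (if j < a * c then (j div a) * (a + b) + j mod a
     else ((j - a * c) div b) * (a + b) + a + (j - a * c) mod b)"

lemma swapP_permmat: "swapP m n = permmat (m + n) (swapP_idx m n)"
  unfolding swapP_def swapP_idx_def ..

lemma swapT_permmat: "swapT m n = permmat (m * n) (swapT_idx m n)"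
  unfolding swapT_def swapT_idx_def ..

lemma dshP_permmat: "dshP a b c = permmat ((a + b) * c) (dshP_idx a b c)"
  unfolding dshP_def dshP_idx_def ..

lemma dim_swap [simp]:
  "dim_row (swapP m n) = m + n" "dim_col (swapP m n) = m + n"
  "dim_row (swapT m n) = m * n" "dim_col (swapT m n) = m * n"
  "dim_row (dshP a b c) = (a + b) * c" "dim_col (dshP a b c) = (a + b) * c"
  by (simp_all add: swapP_permmat swapT_permmat dshP_permmat)

lemma swapP_idx_simps [simp]:
  "j < m \<Longrightarrow> swapP_idx m n j = n + j" "swapP_idx m n (m + j) = j"
  by (simp_all add: swapP_idx_def)

lemma swapT_idx_pair [simp]: "i < m \<Longrightarrow> swapT_idx m n (i + m * k) = k + n * i"
  by (simp add: swapT_idx_def)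

text \<open>In pair notation the distributor only changes the stride to a + b. The first coordinate
  is kept on the first summand and shifted by \<open>a\<close> on the second.\<close>

lemma dshP_idx_left [simp]:
  "i < a \<Longrightarrow> k < c \<Longrightarrow> dshP_idx a b c (i + a * k) = i + (a + b) * k"
  by (simp add: dshP_idx_def pair_index_less)

lemma dshP_idx_right [simp]:
  "i < b \<Longrightarrow> dshP_idx a b c (a * c + (i + b * k)) = (a + i) + (a + b) * k"
  by (simp add: dshP_idx_def)

lemma add_index_cases:
  fixes j :: nat
  assumes "j < m + n"
  obtains (left) "j < m" | (right) i where "i < n" "j = m + i"
  using assms by (metis add_less_cancel_left le_Suc_ex not_less)

lemma swapP_idx_less: "j < m + n \<Longrightarrow> swapP_idx m n j < m + n"
  by (auto simp: swapP_idx_def)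

lemma swapP_idx_inverse: "j < m + n \<Longrightarrow> swapP_idx n m (swapP_idx m n j) = j"
  by (auto simp: swapP_idx_def)

lemma swapT_idx_less: "j < m * n \<Longrightarrow> swapT_idx m n j < m * n"
  by (elim pair_index_cases) (simp add: pair_index_less mult.commute[of m n])

lemma swapT_idx_inverse: "j < m * n \<Longrightarrow> swapT_idx n m (swapT_idx m n j) = j"
  by (elim pair_index_cases) simp

lemma dshP_cases:
  fixes j :: nat
  assumes "j < (a + b) * c"
  obtains (left) i k where "i < a" "k < c" "j = i + a * k"
    | (right) i k where "i < b" "k < c" "j = a * c + (i + b * k)"
proof -
  have "j < a * c + b * c" using assms by (simp add: algebra_simps)
  then show thesis
  proof (cases rule: add_index_cases)
    case left
    then show thesis using that(1) by (metis pair_index_cases)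
  next
    case (right i)
    then show thesis using that(2) by (metis pair_index_cases)
  qed
qed

lemma dshP_idx_less: "j < (a + b) * c \<Longrightarrow> dshP_idx a b c j < (a + b) * c"
  by (elim dshP_cases) (simp_all add: pair_index_less)

lemma dshP_idx_inj: "inj_on (dshP_idx a b c) {..<(a + b) * c}"
proof (rule inj_on_inverseI)
  fix j assume "j \<in> {..<(a + b) * c}"
  then have "j < (a + b) * c" by simp
  \<comment> \<open>The left inverse decodes with stride a + b; whether the first coordinate lies
    below \<open>a\<close> tells the summand.\<close>
  then show "(\<lambda>r. if r mod (a + b) < a then r mod (a + b) + a * (r div (a + b))
      else a * c + ((r mod (a + b) - a) + b * (r div (a + b)))) (dshP_idx a b c j) = j"
    by (cases rule: dshP_cases) simp_all
qed

lemma swapP_idx_inj: "inj_on (swapP_idx m n) {..<m + n}"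
  by (rule inj_on_inverseI[of _ "swapP_idx n m"]) (simp add: swapP_idx_inverse)

lemma swapT_idx_inj: "inj_on (swapT_idx m n) {..<m * n}"
  by (rule inj_on_inverseI[of _ "swapT_idx n m"]) (simp add: swapT_idx_inverse)

lemma one_permmat: "1\<^sub>m n = permmat n (\<lambda>j. j)"
  by (simp add: permmat_id)

lemma dsum_permmat_one:
  assumes "\<And>j. j < m \<Longrightarrow> s j < m"
  shows "dsum (permmat m s) (1\<^sub>m n) = permmat (m + n) (\<lambda>j. if j < m then s j else j)"
  unfolding one_permmat by (subst dsum_permmat) (auto simp: assms intro: permmat_cong)

lemma dsum_one_permmat:
  "dsum (1\<^sub>m m) (permmat n t) = permmat (m + n) (\<lambda>j. if j < m then j else m + t (j - m))"
  unfolding one_permmat by (subst dsum_permmat) auto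

lemma kron_permmat_one:
  assumes "\<And>j. j < m \<Longrightarrow> s j < m"
  shows "kron (permmat m s) (1\<^sub>m n) = permmat (m * n) (\<lambda>j. s (j mod m) + m * (j div m))"
  unfolding one_permmat by (subst kron_permmat) (simp_all add: assms)

lemma kron_one_permmat:
  "kron (1\<^sub>m m) (permmat n t) = permmat (m * n) (\<lambda>j. j mod m + m * t (j div m))"
  unfolding one_permmat by (subst kron_permmat) auto

subsection \<open>The two symmetries\<close>

lemma swapP_natural:
  "swapP (dim_row f) (dim_row g) * dsum f g = dsum g f * swapP (dim_col f) (dim_col g)"
  unfolding swapP_permmat
proof (rule permmat_intertwine)
  fix i j assume "i < dim_row f + dim_row g" "j < dim_col f + dim_col g"
  then show "dsum g f $$ (swapP_idx (dim_row f) (dim_row g) i, swapP_idx (dim_col f) (dim_col g) j)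
      = dsum f g $$ (i,j)"
    by (elim add_index_cases) simp_all
qed (simp_all add: swapP_idx_less swapP_idx_inj)

lemma swapP_swapP: "swapP n m * swapP m n = 1\<^sub>m (m + n)"
  unfolding swapP_permmat
  by (simp add: add.commute[of n m] permmat_mult swapP_idx_less permmat_id swapP_idx_inverse)

lemma swapP_0 [simp]: "swapP m 0 = 1\<^sub>m m"
  unfolding swapP_permmat by (simp add: permmat_id)

lemma swapP_hexagon:
  "swapP a (b + c) = dsum (1\<^sub>m b) (swapP a c) * dsum (swapP a b) (1\<^sub>m c)"
proof -
  \<comment> \<open>The two factors arrive with differently bracketed sizes;
    \<open>permmat_mult\<close> needs the same expression for both.\<close>
  have eq: "a + b + c = b + (a + c)" by simp
  have "dsum (1\<^sub>m b) (swapP a c) * dsum (swapP a b) (1\<^sub>m c) =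
     permmat (a + (b + c)) ((\<lambda>j. if j < b then j else b + swapP_idx a c (j - b)) \<circ>
       (\<lambda>j. if j < a + b then swapP_idx a b j else j))"
    unfolding swapP_permmat dsum_one_permmat
    by (subst dsum_permmat_one, simp add: swapP_idx_less, unfold eq, subst permmat_mult)
       (auto simp: swapP_idx_def add.left_commute)
  also have "\<dots> = swapP a (b + c)"
    unfolding swapP_permmat by (rule permmat_cong) (auto simp: swapP_idx_def)
  finally show ?thesis ..
qed

lemma swapT_natural:
  "swapT (dim_row f) (dim_row g) * kron f g = kron g f * swapT (dim_col f) (dim_col g)"
  unfolding swapT_permmat
proof (rule permmat_intertwine)
  fix i j assume "i < dim_row f * dim_row g" "j < dim_col f * dim_col g"
  then show "kron g f $$ (swapT_idx (dim_row f) (dim_row g) i, swapT_idx (dim_col f) (dim_col g) j)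
      = kron f g $$ (i,j)"
    by (elim pair_index_cases) (simp del: index_kron)
qed (simp_all add: swapT_idx_less swapT_idx_inj)

lemma swapT_swapT: "swapT n m * swapT m n = 1\<^sub>m (m * n)"
  unfolding swapT_permmat
  by (simp add: mult.commute[of n m] permmat_mult swapT_idx_less permmat_id swapT_idx_inverse)

lemma swapT_1 [simp]: "swapT m (Suc 0) = 1\<^sub>m m"
  unfolding swapT_permmat by (simp add: permmat_id swapT_idx_def)

lemma swapT_0 [simp]: "swapT m 0 = 1\<^sub>m 0" "swapT 0 m = 1\<^sub>m 0"
  unfolding swapT_permmat by (simp_all add: permmat_id)

lemma triple_index_cases:
  fixes j :: nat
  assumes "j < a * (b * c)"
  obtains i k l where "i < a" "k < b" "l < c" "j = i + a * (k + b * l)"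
  using assms by (metis pair_index_cases)

lemma triple_index: "i + a * (k + b * l) = (i + a * k) + (a * b) * l" for a b i k l :: nat
  by (simp add: algebra_simps)

lemma swapT_hexagon:
  "swapT a (b * c) = kron (1\<^sub>m b) (swapT a c) * kron (swapT a b) (1\<^sub>m c)"
proof -
  have eq: "a * b * c = b * (a * c)" by simp
  let ?s = "\<lambda>j. swapT_idx a b (j mod (a * b)) + a * b * (j div (a * b))"
  \<comment> \<open>On three-digit indices \<open>?s\<close> exchanges the first two digits. The
    other factor then exchanges the last two, which together moves the first digit to the
    end.\<close>
  have s: "?s (i + a * (k + b * l)) = k + b * (i + a * l)" "?s (i + a * (k + b * l)) < b * (a * c)"
    if "i < a" "k < b" "l < c" for i k l
  proof -
    have "?s ((i + a * k) + (a * b) * l) = (k + b * i) + (a * b) * l"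
      using that by (simp add: pair_index_less)
    then show "?s (i + a * (k + b * l)) = k + b * (i + a * l)"
      unfolding triple_index by (simp add: algebra_simps)
    then show "?s (i + a * (k + b * l)) < b * (a * c)" using that by (simp add: pair_index_less)
  qed
  have "kron (1\<^sub>m b) (swapT a c) * kron (swapT a b) (1\<^sub>m c) =
     permmat (b * (a * c)) ((\<lambda>j. j mod b + b * swapT_idx a c (j div b)) \<circ> ?s)"
    unfolding swapT_permmat kron_one_permmat
  proof (subst kron_permmat_one, simp add: swapT_idx_less, unfold eq, rule permmat_mult)
    fix j assume "j < b * (a * c)"
    then have "j < a * (b * c)" by (simp add: algebra_simps)
    then show "?s j < b * (a * c)" by (elim triple_index_cases) (use s in blast)
  qed
  also have "\<dots> = permmat (a * (b * c)) ((\<lambda>j. j mod b + b * swapT_idx a c (j div b)) \<circ> ?s)"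
    by (simp add: algebra_simps)
  also have "\<dots> = swapT a (b * c)"
    unfolding swapT_permmat
  proof (rule permmat_cong)
    fix j assume "j < a * (b * c)"
    then obtain i k l where *: "i < a" "k < b" "l < c" "j = i + a * (k + b * l)"
      by (rule triple_index_cases)
    show "((\<lambda>j. j mod b + b * swapT_idx a c (j div b)) \<circ> ?s) j = swapT_idx a (b * c) j"
      unfolding o_def *(4) s(1)[OF *(1-3)] pair_index_mod[OF *(2)] pair_index_div[OF *(2)]
        swapT_idx_pair[OF *(1)]
      by (simp add: algebra_simps)
  qed
  finally show ?thesis ..
qed

subsection \<open>The distributor\<close>

lemma dshP_natural:
  "dshP (dim_row f) (dim_row g) (dim_row h) * dsum (kron f h) (kron g h) =
   kron (dsum f g) h * dshP (dim_col f) (dim_col g) (dim_col h)"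
  unfolding dshP_permmat
proof (rule permmat_intertwine)
  fix i j
  assume i: "i < (dim_row f + dim_row g) * dim_row h" and j: "j < (dim_col f + dim_col g) * dim_col h"
  have pair: "kron (dsum f g) h $$ (i + (dim_row f + dim_row g) * k, j + (dim_col f + dim_col g) * l) =
      dsum f g $$ (i,j) * h $$ (k,l)"
    if "i < dim_row f + dim_row g" "k < dim_row h" "j < dim_col f + dim_col g" "l < dim_col h" for i j k l
    using index_kron_pair[of i "dsum f g" k h j l] that by simp
  have less: "i + m * k < m * c + n * c" if "i < m" "k < c" for i k m n c :: nat
    using pair_index_less[OF that] by simp
  show "kron (dsum f g) h $$ (dshP_idx (dim_row f) (dim_row g) (dim_row h) i,
      dshP_idx (dim_col f) (dim_col g) (dim_col h) j) = dsum (kron f h) (kron g h) $$ (i,j)"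
    using i
  proof (cases rule: dshP_cases)
    case l: (left i' k)
    show ?thesis using j
      by (cases rule: dshP_cases)
        (use l in \<open>simp_all add: pair less pair_index_less del: index_kron\<close>)
  next
    case r: (right i' k)
    show ?thesis using j
      by (cases rule: dshP_cases)
        (use r in \<open>simp_all add: pair less pair_index_less del: index_kron\<close>)
  qed
qed (simp_all add: dshP_idx_less dshP_idx_inj distrib_right[symmetric])

lemma kron_one_swapP: "kron (1\<^sub>m a) (swapP b c) = swapP (a * b) (a * c)"
proof -
  have "permmat (a * (b + c)) (\<lambda>j. j mod a + a * swapP_idx b c (j div a)) =
      permmat (a * (b + c)) (swapP_idx (a * b) (a * c))"
  proof (rule permmat_cong)
    fix j assume "j < a * (b + c)"
    then show "j mod a + a * swapP_idx b c (j div a) = swapP_idx (a * b) (a * c) j"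
      by (cases rule: pair_index_sum_cases) (simp_all add: pair_index_less distrib_left)
  qed
  then show ?thesis
    unfolding swapP_permmat kron_one_permmat by (simp add: algebra_simps)
qed

lemma dshP_swapP:
  "dshP b a c * swapP (a * c) (b * c) = kron (swapP a b) (1\<^sub>m c) * dshP a b c"
proof -
  let ?n = "(a + b) * c"
  have L: "dshP b a c * swapP (a * c) (b * c) = permmat ?n (dshP_idx b a c \<circ> swapP_idx (a * c) (b * c))"
    unfolding swapP_permmat dshP_permmat using swapP_idx_less[of _ "a * c" "b * c"]
    by (simp add: permmat_mult algebra_simps)
  have R: "kron (swapP a b) (1\<^sub>m c) * dshP a b c =
      permmat ?n ((\<lambda>j. swapP_idx a b (j mod (a + b)) + (a + b) * (j div (a + b))) \<circ> dshP_idx a b c)"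
    unfolding swapP_permmat dshP_permmat
    by (subst kron_permmat_one, simp add: swapP_idx_less, subst permmat_mult) (simp_all add: dshP_idx_less)
  show ?thesis unfolding L R
  proof (rule permmat_cong)
    fix j assume "j < ?n"
    then show "(dshP_idx b a c \<circ> swapP_idx (a * c) (b * c)) j =
       ((\<lambda>j. swapP_idx a b (j mod (a + b)) + (a + b) * (j div (a + b))) \<circ> dshP_idx a b c) j"
      by (cases rule: dshP_cases) (simp_all add: pair_index_less add.commute[of b a])
  qed
qed

lemma swapT_dshP: "swapT (a + b) c * dshP a b c = dsum (swapT a c) (swapT b c)"
proof -
  have "swapT (a + b) c * dshP a b c = permmat ((a + b) * c) (swapT_idx (a + b) c \<circ> dshP_idx a b c)"
    unfolding swapT_permmat dshP_permmat by (rule permmat_mult) (rule dshP_idx_less)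
  also have "\<dots> = permmat ((a + b) * c)
      (\<lambda>j. if j < a * c then swapT_idx a c j else a * c + swapT_idx b c (j - a * c))"
  proof (rule permmat_cong)
    fix j assume "j < (a + b) * c"
    then show "(swapT_idx (a + b) c \<circ> dshP_idx a b c) j =
        (if j < a * c then swapT_idx a c j else a * c + swapT_idx b c (j - a * c))"
      by (cases rule: dshP_cases) (simp_all add: pair_index_less distrib_left mult.commute[of c a])
  qed
  also have "\<dots> = dsum (swapT a c) (swapT b c)"
    unfolding swapT_permmat by (subst dsum_permmat) (simp_all add: swapT_idx_less distrib_right)
  finally show ?thesis .
qed

text \<open>The coherence law \<open>swapT_dshP\<close> is solved for the distributor by cancelling
  the symmetry against its inverse.\<close>

lemma dshP_eq: "dshP a b c = swapT c (a + b) * dsum (swapT a c) (swapT b c)"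
proof -
  have "swapT c (a + b) * (swapT (a + b) c * dshP a b c) = dshP a b c"
    by (subst mat_mult_assoc[symmetric]) (simp_all add: swapT_swapT algebra_simps)
  then show ?thesis by (simp add: swapT_dshP)
qed

text \<open>A symmetry after a distributor is a sum of symmetries. Applied twice, this turns each of
  the two composites compared in \<open>dshP_assoc\<close> into the same threefold sum, with no
  index computation.\<close>

lemma dsum_dshP_left:
  "swapT (a + b + c) d * (dshP (a + b) c d * dsum (dshP a b d) (1\<^sub>m (c * d))) =
   dsum (dsum (swapT a d) (swapT b d)) (swapT c d)"
  by (subst mat_mult_assoc[symmetric])
     (simp_all add: swapT_dshP dsum_mult distrib_right)

lemma dsum_dshP_right:
  "swapT (a + b + c) d * (dshP a (b + c) d * dsum (1\<^sub>m (a * d)) (dshP b c d)) =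
   dsum (dsum (swapT a d) (swapT b d)) (swapT c d)"
  by (subst mat_mult_assoc[symmetric])
     (simp_all add: swapT_dshP[of a "b + c", unfolded add.assoc[symmetric]] swapT_dshP dsum_mult dsum_assoc distrib_right)

lemma swapT_cancel:
  assumes "swapT m n * A = swapT m n * B" "dim_row A = m * n" "dim_row B = m * n"
  shows "A = B"
proof -
  have *: "swapT n m * (swapT m n * X) = X" if "dim_row X = m * n" for X
    by (subst mat_mult_assoc[symmetric]) (simp_all add: that swapT_swapT mult.commute[of n m])
  have "A = swapT n m * (swapT m n * A)" using *[OF assms(2)] by (rule sym)
  also have "\<dots> = B" unfolding assms(1) by (rule *[OF assms(3)])
  finally show ?thesis .
qed

lemma dshP_assoc:
  "dshP (a + b) c d * dsum (dshP a b d) (1\<^sub>m (c * d)) = dshP a (b + c) d * dsum (1\<^sub>m (a * d)) (dshP b c d)"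
  by (rule swapT_cancel[of "a + b + c" d])
     (simp only: dsum_dshP_left dsum_dshP_right, simp_all add: add.assoc)

lemma dshP_mult:
  "dshP a b (c * d) = kron (dshP a b c) (1\<^sub>m d) * dshP (a * c) (b * c) d"
proof -
  let ?n = "(a + b) * (c * d)"
  have n: "(a + b) * c * d = ?n" "(a * c + b * c) * d = ?n" by (simp_all add: algebra_simps)
  have less: "dshP_idx (a * c) (b * c) d j < ?n" if "j < ?n" for j
    using dshP_idx_less[of j "a * c" "b * c" d] that unfolding n .
  have "kron (dshP a b c) (1\<^sub>m d) * dshP (a * c) (b * c) d =
      permmat ?n ((\<lambda>j. dshP_idx a b c (j mod ((a + b) * c)) + (a + b) * c * (j div ((a + b) * c))) \<circ>
        dshP_idx (a * c) (b * c) d)"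
    unfolding dshP_permmat
    by (subst kron_permmat_one, simp add: dshP_idx_less, unfold n, subst permmat_mult) (simp_all add: less)
  also have "\<dots> = permmat ?n (dshP_idx a b (c * d))"
  proof (rule permmat_cong)
    fix j assume "j < ?n"
    then show "((\<lambda>j. dshP_idx a b c (j mod ((a + b) * c)) + (a + b) * c * (j div ((a + b) * c))) \<circ>
        dshP_idx (a * c) (b * c) d) j = dshP_idx a b (c * d) j"
    proof (cases rule: dshP_cases)
      case (left i kl)
      then obtain k l where kl: "k < c" "l < d" "kl = k + c * l" by (elim pair_index_cases)
      have less: "i + a * k < a * c" using left kl by (simp add: pair_index_less)
      \<comment> \<open>The inner distributor has stride a * c + b * c, that is (a + b) * c. Its
        value is therefore a pair for the outer map, which acts on the lower digit only and leaves
        \<open>l\<close> alone.\<close>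
      have "dshP_idx (a * c) (b * c) d j = (i + a * k) + (a * c + b * c) * l"
        unfolding left(3) kl(3) triple_index using left kl by (subst dshP_idx_left) (simp_all add: pair_index_less)
      also have "\<dots> = (i + a * k) + ((a + b) * c) * l" by (simp add: distrib_right)
      finally have *: "dshP_idx (a * c) (b * c) d j = (i + a * k) + ((a + b) * c) * l" .
      have "dshP_idx a b c (i + a * k) = i + (a + b) * k" using left kl by simp
      moreover have "dshP_idx a b (c * d) j = i + (a + b) * kl" using left by simp
      moreover have "i + a * k < (a + b) * c" using less by (simp add: distrib_right)
      ultimately show ?thesis
        unfolding o_def * using kl(3) by (simp only: pair_index_mod pair_index_div) (simp add: algebra_simps)
    next
      case (right i kl)
      then obtain k l where kl: "k < c" "l < d" "kl = k + c * l" by (elim pair_index_cases)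
      have less: "i + b * k < b * c" using right kl by (simp add: pair_index_less)
      have j: "j = a * c * d + ((i + b * k) + (b * c) * l)"
        using right kl by (simp add: algebra_simps)
      have *: "dshP_idx (a * c) (b * c) d j = (a * c + (i + b * k)) + ((a + b) * c) * l"
        unfolding j using less by (subst dshP_idx_right) (simp_all add: distrib_right)
      have "dshP_idx a b c (a * c + (i + b * k)) = (a + i) + (a + b) * k"
        using right kl by simp
      moreover have "dshP_idx a b (c * d) j = (a + i) + (a + b) * kl"
        using right by simp
      moreover have "a * c + (i + b * k) < (a + b) * c" using less by (simp add: distrib_right)
      ultimately show ?thesis
        unfolding o_def * using kl(3) by (simp only: pair_index_mod pair_index_div) (simp add: algebra_simps)
    qed
  qed
  finally show ?thesis by (simp add: dshP_permmat)
qed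

lemma kron_one_dshP: "kron (1\<^sub>m a) (dshP b c d) = dshP (a * b) (a * c) d"
proof -
  let ?n = "a * ((b + c) * d)"
  have n: "(a * b + a * c) * d = ?n" by (simp add: algebra_simps)
  have "permmat ?n (\<lambda>j. j mod a + a * dshP_idx b c d (j div a)) = permmat ?n (dshP_idx (a * b) (a * c) d)"
  proof (rule permmat_cong)
    fix j assume "j < ?n"
    then obtain i r where ir: "i < a" "r < (b + c) * d" "j = i + a * r" by (rule pair_index_cases)
    have "a * dshP_idx b c d r + i = dshP_idx (a * b) (a * c) d (i + a * r)"
      using ir(2)
    proof (cases rule: dshP_cases)
      case (left k l)
      \<comment> \<open>The digits \<open>i\<close>, \<open>k\<close>, \<open>l\<close> are
        regrouped: \<open>i\<close> and \<open>k\<close> together form the first coordinate for the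
        distributor at a * b and a * c.\<close>
      have "dshP_idx (a * b) (a * c) d ((i + a * k) + (a * b) * l) = (i + a * k) + (a * b + a * c) * l"
        using left ir by (intro dshP_idx_left) (simp_all add: pair_index_less)
      moreover have "i + a * r = (i + a * k) + (a * b) * l" using left by (simp add: algebra_simps)
      ultimately show ?thesis using left by (simp add: algebra_simps del: dshP_idx_right)
    next
      case (right k l)
      have "dshP_idx (a * b) (a * c) d (a * b * d + ((i + a * k) + (a * c) * l)) =
          (a * b + (i + a * k)) + (a * b + a * c) * l"
        using right ir by (intro dshP_idx_right) (simp_all add: pair_index_less)
      moreover have "i + a * r = a * b * d + ((i + a * k) + (a * c) * l)"
        using right by (simp add: algebra_simps)
      moreover have "dshP_idx b c d r = (b + k) + (b + c) * l" using right by simp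
      ultimately show ?thesis by (simp add: algebra_simps del: dshP_idx_right)
    qed
    then show "j mod a + a * dshP_idx b c d (j div a) = dshP_idx (a * b) (a * c) d j"
      using ir by (simp add: add.commute)
  qed
  then show ?thesis unfolding dshP_permmat kron_one_permmat n .
qed

text \<open>The sum of distributors starts from the four summands ac, bc, ad, bd, whereas the single
  distributor expects ac, ad, bc, bd. The symmetry exchanges the two middle ones.\<close>

lemma dshP_add:
  "dshP a b (c + d) * dsum (1\<^sub>m (a * c)) (dsum (swapP (b * c) (a * d)) (1\<^sub>m (b * d))) =
   dsum (dshP a b c) (dshP a b d)"
proof -
  let ?n = "(a + b) * (c + d)"
  have n: "a * c + (b * c + a * d + b * d) = ?n" "(a + b) * c + (a + b) * d = ?n"
    by (simp_all add: algebra_simps)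
  let ?t = "\<lambda>j. if j < b * c + a * d then swapP_idx (b * c) (a * d) j else j"
  let ?s = "\<lambda>j. if j < a * c then j else a * c + ?t (j - a * c)"
  have less: "?s j < ?n" if "j < ?n" for j
    using that unfolding n(1)[symmetric] by (auto simp: swapP_idx_def)
  have "dshP a b (c + d) * dsum (1\<^sub>m (a * c)) (dsum (swapP (b * c) (a * d)) (1\<^sub>m (b * d))) =
     permmat ?n (dshP_idx a b (c + d) \<circ> ?s)"
    unfolding dshP_permmat swapP_permmat
    by (subst dsum_permmat_one, simp add: swapP_idx_less, subst dsum_one_permmat, unfold n,
        subst permmat_mult) (rule less, simp_all)
  also have "\<dots> = permmat ?n (\<lambda>j. if j < (a + b) * c then dshP_idx a b c j
      else (a + b) * c + dshP_idx a b d (j - (a + b) * c))"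
  proof (rule permmat_cong)
    fix j assume "j < ?n"
    then have "j < (a + b) * c + (a + b) * d" unfolding n .
    then show "(dshP_idx a b (c + d) \<circ> ?s) j = (if j < (a + b) * c then dshP_idx a b c j
      else (a + b) * c + dshP_idx a b d (j - (a + b) * c))"
    \<comment> \<open>The nested cases are the four summands ac, bc, ad, bd in this order. In the
      last two the second coordinate is shifted by \<open>c\<close>.\<close>
    proof (cases rule: add_index_cases)
      case left
      from left show ?thesis
      proof (cases rule: dshP_cases)
        case (left i k)
        then have "i + a * k < a * c" by (simp add: pair_index_less)
        then show ?thesis using left \<open>j < (a + b) * c\<close> by simp
      next
        case (right i k)
        have "i + b * k < b * c" using right by (simp add: pair_index_less)
        then have s: "?s j = a * (c + d) + (i + b * k)" using right by (simp add: algebra_simps)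
        show ?thesis unfolding o_def s using right \<open>j < (a + b) * c\<close> by simp
      qed
    next
      case outer: (right r)
      from outer(1) show ?thesis
      proof (cases rule: dshP_cases)
        case (left i k)
        have "i + a * k < a * d" using left by (simp add: pair_index_less)
        moreover have "j - a * c = b * c + (i + a * k)" using left outer by (simp add: distrib_right)
        moreover have "\<not> j < a * c" using outer by (simp add: distrib_right)
        ultimately have s: "?s j = i + a * (c + k)" by (simp add: distrib_left)
        have e: "dshP_idx a b (c + d) (i + a * (c + k)) = i + (a + b) * (c + k)"
          using left by (intro dshP_idx_left) auto
        show ?thesis unfolding o_def s e using left outer by (simp add: distrib_left)
      next
        case (right i k)
        have "j - a * c = b * c + a * d + (i + b * k)" using right outer by (simp add: distrib_right)
        moreover have "\<not> j < a * c" using outer by (simp add: distrib_right)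
        ultimately have s: "?s j = a * (c + d) + (i + b * (c + k))" by (simp add: distrib_left)
        have e: "dshP_idx a b (c + d) (a * (c + d) + (i + b * (c + k))) = (a + i) + (a + b) * (c + k)"
          using right by (intro dshP_idx_right) auto
        show ?thesis unfolding o_def s e using right outer by (simp add: distrib_left)
      qed
    qed
  qed
  also have "\<dots> = dsum (dshP a b c) (dshP a b d)"
    unfolding dshP_permmat by (subst dsum_permmat) (simp_all add: dshP_idx_less n)
  finally show ?thesis .
qed

lemma dshP_1 [simp]: "dshP a b (Suc 0) = 1\<^sub>m (a + b)"
  unfolding dshP_permmat by (auto simp: dshP_idx_def intro!: permmat_id)

lemma dshP_0 [simp]:
  "dshP 0 b c = 1\<^sub>m (b * c)" "dshP a 0 c = 1\<^sub>m (a * c)" "dshP a b 0 = 1\<^sub>m 0"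
  unfolding dshP_permmat by (auto simp: dshP_idx_def intro!: permmat_id)

subsection \<open>Categories of complex matrices\<close>

text \<open>The two categories of the theorem differ only in their arrows, so bipermutativity is
  proved once with the set of arrows as a parameter.\<close>

definition mat_bipcat :: "complex mat set \<Rightarrow> (nat, complex mat) bipcat" where
  "mat_bipcat A = \<lparr> Obj = UNIV, Arr = A,
     Dom = dim_col, Cod = dim_row, Cmp = (\<lambda>g f. g * f), Idm = (\<lambda>n. 1\<^sub>m n),
     PlO = (+), PlM = dsum, Nul = 0, Gam = swapP,
     TmO = (*), TmM = kron, Unt = 1, GamT = swapT, Dsh = dshP \<rparr>"

lemma mat_bipcat_simps [simp]:
  "Obj (mat_bipcat A) = UNIV" "Arr (mat_bipcat A) = A" "Dom (mat_bipcat A) = dim_col"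
  "Cod (mat_bipcat A) = dim_row" "Cmp (mat_bipcat A) g f = g * f" "Idm (mat_bipcat A) n = 1\<^sub>m n"
  "PlO (mat_bipcat A) = (+)" "PlM (mat_bipcat A) = dsum" "Nul (mat_bipcat A) = 0"
  "Gam (mat_bipcat A) = swapP" "TmO (mat_bipcat A) = (*)" "TmM (mat_bipcat A) = kron"
  "Unt (mat_bipcat A) = 1" "GamT (mat_bipcat A) = swapT" "Dsh (mat_bipcat A) = dshP"
  by (simp_all add: mat_bipcat_def)

text \<open>Closure under adjoints is conditional because the adjoint of an isometry is an isometry
  only in the unitary case. It provides the inverse of the distributor.\<close>

locale matrix_class =
  fixes A :: "complex mat set"
  assumes mult_closed: "f \<in> A \<Longrightarrow> g \<in> A \<Longrightarrow> dim_col g = dim_row f \<Longrightarrow> g * f \<in> A"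
    and dsum_closed: "f \<in> A \<Longrightarrow> g \<in> A \<Longrightarrow> dsum f g \<in> A"
    and kron_closed: "f \<in> A \<Longrightarrow> g \<in> A \<Longrightarrow> kron f g \<in> A"
    and permmat_closed: "(\<And>i. i < n \<Longrightarrow> s i < n) \<Longrightarrow> inj_on s {..<n} \<Longrightarrow> permmat n s \<in> A"
    and cadj_closed: "f \<in> A \<Longrightarrow> f * cadj f = 1\<^sub>m (dim_row f) \<Longrightarrow> cadj f \<in> A"
begin

lemma one_closed: "1\<^sub>m n \<in> A"
  unfolding one_permmat by (rule permmat_closed) auto

lemma swapP_closed: "swapP m n \<in> A"
  unfolding swapP_permmat by (rule permmat_closed) (simp_all add: swapP_idx_less swapP_idx_inj)

lemma swapT_closed: "swapT m n \<in> A"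
  unfolding swapT_permmat by (rule permmat_closed) (simp_all add: swapT_idx_less swapT_idx_inj)

lemma dshP_closed: "dshP a b c \<in> A"
  unfolding dshP_permmat by (rule permmat_closed) (simp_all only: dshP_idx_less dshP_idx_inj)

lemma dshP_unitary:
  "cadj (dshP a b c) * dshP a b c = 1\<^sub>m ((a + b) * c)" "dshP a b c * cadj (dshP a b c) = 1\<^sub>m ((a + b) * c)"
  unfolding dshP_permmat by (rule permmat_unitary; simp only: dshP_idx_less dshP_idx_inj)+

lemma dshP_iso: "is_iso (mat_bipcat A) (dshP a b c)"
  unfolding is_iso_def hom_def
  by (intro conjI bexI[of _ "cadj (dshP a b c)"]) (auto simp: dshP_unitary dshP_closed cadj_closed)

lemma is_category_mat: "is_category (mat_bipcat A)"
  unfolding is_category_def hom_def by (auto simp: one_closed mult_closed mat_mult_assoc)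

lemma permutative_dsum: "permutative (mat_bipcat A) (+) dsum 0 swapP"
  unfolding permutative_def hom_def
  by (auto simp: dsum_closed swapP_closed dsum_mult dsum_assoc swapP_natural swapP_swapP
      swapP_hexagon add.commute)

lemma permutative_kron: "permutative (mat_bipcat A) (*) kron 1 swapT"
  unfolding permutative_def hom_def
  by (auto simp: kron_closed swapT_closed kron_mult kron_assoc swapT_natural swapT_swapT
      swapT_hexagon mult.commute)

lemma bipermutative_mat: "bipermutative (mat_bipcat A)"
  unfolding bipermutative_def mat_bipcat_simps hom_def
  by (intro conjI ballI; (rule is_category_mat permutative_dsum permutative_kron
        dshP_natural dshP_swapP dshP_assoc dshP_mult kron_one_dshP dshP_add swapT_dshP
        kron_one_swapP kron_dsum_distrib dshP_iso)?)
     (auto simp: dshP_closed algebra_simps)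

end

section \<open>Unitary and isometric matrices as instances\<close>

definition unitary_mat :: "complex mat \<Rightarrow> bool" where
  "unitary_mat U \<longleftrightarrow> dim_row U = dim_col U \<and> cadj U * U = 1\<^sub>m (dim_col U) \<and> U * cadj U = 1\<^sub>m (dim_row U)"

definition isometry_mat :: "complex mat \<Rightarrow> bool" where
  "isometry_mat V \<longleftrightarrow> cadj V * V = 1\<^sub>m (dim_col V)"

lemma unitary_cat_eq: "unitary_cat = mat_bipcat {U. unitary_mat U}"
  by (simp add: unitary_cat_def mat_bipcat_def unitary_mat_def)

lemma isometry_cat_eq: "isometry_cat = mat_bipcat {V. isometry_mat V}"
  by (simp add: isometry_cat_def mat_bipcat_def isometry_mat_def)

lemma isometry_mult:
  assumes "isometry_mat f" "isometry_mat g" "dim_col g = dim_row f"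
  shows "isometry_mat (g * f)"
proof -
  have "cadj (g * f) * (g * f) = cadj f * ((cadj g * g) * f)"
    using assms(3) by (simp add: cadj_mult mat_mult_assoc)
  also have "\<dots> = 1\<^sub>m (dim_col f)" using assms by (simp add: isometry_mat_def)
  finally show ?thesis by (simp add: isometry_mat_def)
qed

lemma isometry_dsum: "isometry_mat f \<Longrightarrow> isometry_mat g \<Longrightarrow> isometry_mat (dsum f g)"
  by (simp add: isometry_mat_def cadj_dsum dsum_mult)

lemma isometry_kron: "isometry_mat f \<Longrightarrow> isometry_mat g \<Longrightarrow> isometry_mat (kron f g)"
  by (simp add: isometry_mat_def cadj_kron kron_mult)

text \<open>Closure properties of unitaries follow from those of isometries, applied to a matrix and
  to its adjoint.\<close>

lemma unitary_iff_isometry: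
  "unitary_mat U \<longleftrightarrow> dim_row U = dim_col U \<and> isometry_mat U \<and> isometry_mat (cadj U)"
  by (auto simp: unitary_mat_def isometry_mat_def)

lemma unitary_mult: "unitary_mat f \<Longrightarrow> unitary_mat g \<Longrightarrow> dim_col g = dim_row f \<Longrightarrow> unitary_mat (g * f)"
  by (auto simp: unitary_iff_isometry isometry_mult cadj_mult)

lemma unitary_dsum: "unitary_mat f \<Longrightarrow> unitary_mat g \<Longrightarrow> unitary_mat (dsum f g)"
  by (auto simp: unitary_iff_isometry isometry_dsum cadj_dsum)

lemma unitary_kron: "unitary_mat f \<Longrightarrow> unitary_mat g \<Longrightarrow> unitary_mat (kron f g)"
  by (auto simp: unitary_iff_isometry isometry_kron cadj_kron)

lemma unitary_cadj: "unitary_mat f \<Longrightarrow> unitary_mat (cadj f)"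
  by (simp add: unitary_iff_isometry)

lemma unitary_one [simp]: "unitary_mat (1\<^sub>m n)"
  by (simp add: unitary_mat_def)

lemma unitary_permmat: "(\<And>i. i < n \<Longrightarrow> s i < n) \<Longrightarrow> inj_on s {..<n} \<Longrightarrow> unitary_mat (permmat n s)"
  by (simp add: unitary_mat_def permmat_unitary)

interpretation unitary: matrix_class "{U. unitary_mat U}"
  by standard (auto simp: unitary_mult unitary_dsum unitary_kron unitary_cadj unitary_permmat)

interpretation isometry: matrix_class "{V. isometry_mat V}"
proof
  show "cadj f \<in> {V. isometry_mat V}" if "f * cadj f = 1\<^sub>m (dim_row f)" for f
    using that by (simp add: isometry_mat_def)
  show "permmat n s \<in> {V. isometry_mat V}" if "\<And>i. i < n \<Longrightarrow> s i < n" "inj_on s {..<n}" for n s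
    using unitary_permmat[OF that] by (simp add: unitary_iff_isometry)
qed (auto simp: isometry_mult isometry_dsum isometry_kron)

lemma bipermutative_unitary: "bipermutative unitary_cat"
  unfolding unitary_cat_eq by (rule unitary.bipermutative_mat)

lemma bipermutative_isometry: "bipermutative isometry_cat"
  unfolding isometry_cat_eq by (rule isometry.bipermutative_mat)

lemma strict_bip_functor_J: "strict_bip_functor unitary_cat isometry_cat J_obj J_mor"
  unfolding strict_bip_functor_def unitary_cat_eq isometry_cat_eq hom_def J_obj_def J_mor_def
  by (auto simp: unitary_iff_isometry)

lemma initial_isometry: "initial_obj isometry_cat (Nul isometry_cat)"
proof -
  have "\<exists>!f. f \<in> {f. isometry_mat f} \<and> dim_col f = 0 \<and> dim_row f = n" for n
  proof (rule ex1I)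
    show "0\<^sub>m n 0 \<in> {f. isometry_mat f} \<and> dim_col (0\<^sub>m n 0 :: complex mat) = 0 \<and> dim_row (0\<^sub>m n 0 :: complex mat) = n"
      by (auto simp: isometry_mat_def intro!: eq_matI)
    show "f = 0\<^sub>m n 0" if "f \<in> {f. isometry_mat f} \<and> dim_col f = 0 \<and> dim_row f = n" for f
      using that by (auto intro!: eq_matI)
  qed
  then show ?thesis unfolding initial_obj_def isometry_cat_eq hom_def by simp
qed

section \<open>Bipermutative categories\<close>

text \<open>The axioms are restated below with hom-set premises in place of equations for
  \<open>Dom\<close> and \<open>Cod\<close>, so that typing facts compose by resolution.\<close>

locale bipermutative_category =
  fixes C :: "('o,'m,'x) bipcat_scheme"
  assumes bip: "bipermutative C"
begin

abbreviation comp (infixr "\<cdot>" 55) where "g \<cdot> f \<equiv> Cmp C g f"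
abbreviation plus_arr (infixr "\<boxplus>" 65) where "f \<boxplus> g \<equiv> PlM C f g"
abbreviation times_arr (infixr "\<boxtimes>" 70) where "f \<boxtimes> g \<equiv> TmM C f g"
abbreviation plus_obj (infixr "+\<^sub>o" 65) where "a +\<^sub>o b \<equiv> PlO C a b"
abbreviation times_obj (infixr "*\<^sub>o" 70) where "a *\<^sub>o b \<equiv> TmO C a b"
abbreviation ide where "ide \<equiv> Idm C"
abbreviation N where "N \<equiv> Nul C"

lemma cat: "is_category C"
  and plus: "permutative C (PlO C) (PlM C) (Nul C) (Gam C)"
  and times: "permutative C (TmO C) (TmM C) (Unt C) (GamT C)"
  using bip unfolding bipermutative_def by simp_all

lemma hom_arr: "f \<in> hom C a b \<Longrightarrow> f \<in> Arr C"
  and hom_dom: "f \<in> hom C a b \<Longrightarrow> Dom C f = a"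
  and hom_cod: "f \<in> hom C a b \<Longrightarrow> Cod C f = b"
  by (simp_all add: hom_def)

lemmas homD = hom_arr hom_dom hom_cod

lemma hom_obj:
  assumes "f \<in> hom C a b" shows "a \<in> Obj C" "b \<in> Obj C"
  using assms cat unfolding is_category_def hom_def by auto

lemma comp_hom: "f \<in> hom C a b \<Longrightarrow> g \<in> hom C b c \<Longrightarrow> g \<cdot> f \<in> hom C a c"
  using cat unfolding is_category_def by (auto simp: hom_def)

lemma id_hom: "a \<in> Obj C \<Longrightarrow> ide a \<in> hom C a a"
  using cat unfolding is_category_def by simp

lemma id_left: "f \<in> hom C a b \<Longrightarrow> ide b \<cdot> f = f"
  and id_right: "f \<in> hom C a b \<Longrightarrow> f \<cdot> ide a = f"
  using cat unfolding is_category_def hom_def by auto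

lemma comp_assoc:
  "f \<in> hom C a b \<Longrightarrow> g \<in> hom C b c \<Longrightarrow> h \<in> hom C c d \<Longrightarrow> (h \<cdot> g) \<cdot> f = h \<cdot> (g \<cdot> f)"
  using cat unfolding is_category_def hom_def by auto

lemma nul_obj: "N \<in> Obj C"
  and plus_obj: "a \<in> Obj C \<Longrightarrow> b \<in> Obj C \<Longrightarrow> a +\<^sub>o b \<in> Obj C"
  and nul_plus: "a \<in> Obj C \<Longrightarrow> N +\<^sub>o a = a"
  and plus_nul: "a \<in> Obj C \<Longrightarrow> a +\<^sub>o N = a"
  and plus_obj_assoc: "a \<in> Obj C \<Longrightarrow> b \<in> Obj C \<Longrightarrow> c \<in> Obj C \<Longrightarrow> (a +\<^sub>o b) +\<^sub>o c = a +\<^sub>o b +\<^sub>o c"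
  and id_plus: "a \<in> Obj C \<Longrightarrow> b \<in> Obj C \<Longrightarrow> ide a \<boxplus> ide b = ide (a +\<^sub>o b)"
  and gam_hom: "a \<in> Obj C \<Longrightarrow> b \<in> Obj C \<Longrightarrow> Gam C a b \<in> hom C (a +\<^sub>o b) (b +\<^sub>o a)"
  and gam_nul: "a \<in> Obj C \<Longrightarrow> Gam C a N = ide a"
  using plus unfolding permutative_def by simp_all

lemma times_obj: "a \<in> Obj C \<Longrightarrow> b \<in> Obj C \<Longrightarrow> a *\<^sub>o b \<in> Obj C"
  and id_times: "a \<in> Obj C \<Longrightarrow> b \<in> Obj C \<Longrightarrow> ide a \<boxtimes> ide b = ide (a *\<^sub>o b)"
  and gamT_hom: "a \<in> Obj C \<Longrightarrow> b \<in> Obj C \<Longrightarrow> GamT C a b \<in> hom C (a *\<^sub>o b) (b *\<^sub>o a)"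
  and gamT_gamT: "a \<in> Obj C \<Longrightarrow> b \<in> Obj C \<Longrightarrow> GamT C b a \<cdot> GamT C a b = ide (a *\<^sub>o b)"
  using times unfolding permutative_def by simp_all

lemma plus_hom:
  assumes "f \<in> hom C a b" "g \<in> hom C c d"
  shows "f \<boxplus> g \<in> hom C (a +\<^sub>o c) (b +\<^sub>o d)"
proof -
  have "\<forall>f\<in>Arr C. \<forall>g\<in>Arr C. f \<boxplus> g \<in> hom C (Dom C f +\<^sub>o Dom C g) (Cod C f +\<^sub>o Cod C g)"
    using plus unfolding permutative_def by simp
  then show ?thesis using assms homD by metis
qed

lemma times_hom:
  assumes "f \<in> hom C a b" "g \<in> hom C c d"
  shows "f \<boxtimes> g \<in> hom C (a *\<^sub>o c) (b *\<^sub>o d)"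
proof -
  have "\<forall>f\<in>Arr C. \<forall>g\<in>Arr C. f \<boxtimes> g \<in> hom C (Dom C f *\<^sub>o Dom C g) (Cod C f *\<^sub>o Cod C g)"
    using times unfolding permutative_def by simp
  then show ?thesis using assms homD by metis
qed

lemma plus_comp:
  assumes "f \<in> hom C a b" "g \<in> hom C b c" "f' \<in> hom C a' b'" "g' \<in> hom C b' c'"
  shows "(g \<boxplus> g') \<cdot> (f \<boxplus> f') = (g \<cdot> f) \<boxplus> (g' \<cdot> f')"
proof -
  have "\<forall>f\<in>Arr C. \<forall>g\<in>Arr C. \<forall>f'\<in>Arr C. \<forall>g'\<in>Arr C. Cod C f = Dom C g \<and> Cod C f' = Dom C g' \<longrightarrow>
      (g \<cdot> f) \<boxplus> (g' \<cdot> f') = (g \<boxplus> g') \<cdot> (f \<boxplus> f')"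
    using plus unfolding permutative_def by simp
  then show ?thesis using assms homD by metis
qed

lemma times_comp:
  assumes "f \<in> hom C a b" "g \<in> hom C b c" "f' \<in> hom C a' b'" "g' \<in> hom C b' c'"
  shows "(g \<boxtimes> g') \<cdot> (f \<boxtimes> f') = (g \<cdot> f) \<boxtimes> (g' \<cdot> f')"
proof -
  have "\<forall>f\<in>Arr C. \<forall>g\<in>Arr C. \<forall>f'\<in>Arr C. \<forall>g'\<in>Arr C. Cod C f = Dom C g \<and> Cod C f' = Dom C g' \<longrightarrow>
      (g \<cdot> f) \<boxtimes> (g' \<cdot> f') = (g \<boxtimes> g') \<cdot> (f \<boxtimes> f')"
    using times unfolding permutative_def by simp
  then show ?thesis using assms homD by metis
qed

lemma plus_assoc:
  "f \<in> hom C a a' \<Longrightarrow> g \<in> hom C b b' \<Longrightarrow> h \<in> hom C c c' \<Longrightarrow> (f \<boxplus> g) \<boxplus> h = f \<boxplus> g \<boxplus> h"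
  using plus hom_arr unfolding permutative_def by simp

lemma plus_id_nul: "f \<in> hom C a b \<Longrightarrow> f \<boxplus> ide N = f"
  using plus hom_arr unfolding permutative_def by simp

lemma gam_natural:
  assumes "f \<in> hom C a b" "g \<in> hom C c d"
  shows "Gam C b d \<cdot> (f \<boxplus> g) = (g \<boxplus> f) \<cdot> Gam C a c"
proof -
  have "\<forall>f\<in>Arr C. \<forall>g\<in>Arr C. Gam C (Cod C f) (Cod C g) \<cdot> (f \<boxplus> g) = (g \<boxplus> f) \<cdot> Gam C (Dom C f) (Dom C g)"
    using plus unfolding permutative_def by simp
  then show ?thesis using assms homD by metis
qed

lemma distrib:
  "f \<in> hom C a a' \<Longrightarrow> g \<in> hom C b b' \<Longrightarrow> h \<in> hom C c c' \<Longrightarrow> f \<boxtimes> (g \<boxplus> h) = f \<boxtimes> g \<boxplus> f \<boxtimes> h"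
  using bip hom_arr unfolding bipermutative_def by simp

lemma nul_times: "a \<in> Obj C \<Longrightarrow> N *\<^sub>o a = N"
  and times_nul: "a \<in> Obj C \<Longrightarrow> a *\<^sub>o N = N"
  using bip unfolding bipermutative_def by simp_all

lemma dsh_hom:
  "a \<in> Obj C \<Longrightarrow> b \<in> Obj C \<Longrightarrow> c \<in> Obj C \<Longrightarrow> Dsh C a b c \<in> hom C (a *\<^sub>o c +\<^sub>o b *\<^sub>o c) ((a +\<^sub>o b) *\<^sub>o c)"
  and dsh_nul: "a \<in> Obj C \<Longrightarrow> c \<in> Obj C \<Longrightarrow> Dsh C a N c = ide (a *\<^sub>o c)"
  and gamT_dsh: "a \<in> Obj C \<Longrightarrow> b \<in> Obj C \<Longrightarrow> c \<in> Obj C \<Longrightarrow>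
    GamT C (a +\<^sub>o b) c \<cdot> Dsh C a b c = GamT C a c \<boxplus> GamT C b c"
  using bip nul_obj unfolding bipermutative_def by simp_all

lemma dsh_natural:
  assumes "f \<in> hom C a a'" "g \<in> hom C b b'" "h \<in> hom C c c'"
  shows "Dsh C a' b' c' \<cdot> (f \<boxtimes> h \<boxplus> g \<boxtimes> h) = ((f \<boxplus> g) \<boxtimes> h) \<cdot> Dsh C a b c"
proof -
  have "\<forall>f\<in>Arr C. \<forall>g\<in>Arr C. \<forall>h\<in>Arr C. Dsh C (Cod C f) (Cod C g) (Cod C h) \<cdot> (f \<boxtimes> h \<boxplus> g \<boxtimes> h) =
      ((f \<boxplus> g) \<boxtimes> h) \<cdot> Dsh C (Dom C f) (Dom C g) (Dom C h)"
    using bip unfolding bipermutative_def by simp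
  then show ?thesis using assms homD by metis
qed

text \<open>The abstract counterpart of \<open>dshP_eq\<close>, by the same cancellation. The right
  side uses only structure that strict functors preserve by definition.\<close>

lemma dsh_eq:
  assumes "a \<in> Obj C" "b \<in> Obj C" "c \<in> Obj C"
  shows "Dsh C a b c = GamT C c (a +\<^sub>o b) \<cdot> (GamT C a c \<boxplus> GamT C b c)"
proof -
  have "Dsh C a b c = ide ((a +\<^sub>o b) *\<^sub>o c) \<cdot> Dsh C a b c"
    using id_left[OF dsh_hom[OF assms]] by simp
  also have "\<dots> = (GamT C c (a +\<^sub>o b) \<cdot> GamT C (a +\<^sub>o b) c) \<cdot> Dsh C a b c"
    using assms by (simp add: gamT_gamT plus_obj)
  also have "\<dots> = GamT C c (a +\<^sub>o b) \<cdot> (GamT C (a +\<^sub>o b) c \<cdot> Dsh C a b c)"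
    using assms by (intro comp_assoc[OF dsh_hom gamT_hom gamT_hom]) (simp_all add: plus_obj)
  finally show ?thesis using assms by (simp add: gamT_dsh)
qed

end

section \<open>Inclusions of summands when the additive unit is initial\<close>

locale bipermutative_initial = bipermutative_category +
  assumes init: "initial_obj C (Nul C)"
begin

definition bang where "bang a = (THE f. f \<in> hom C N a)"

lemma bang_hom:
  assumes "a \<in> Obj C" shows "bang a \<in> hom C N a"
proof -
  have "\<exists>!f. f \<in> hom C N a" using init assms unfolding initial_obj_def by blast
  then show ?thesis unfolding bang_def by (rule theI')
qed

lemma bang_unique: "f \<in> hom C N a \<Longrightarrow> f = bang a"
  using init bang_hom hom_obj(2) unfolding initial_obj_def by blast

text \<open>Since a + N = a holds on the nose, this is an arrow from \<open>a\<close> itself to the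
  sum of \<open>a\<close> and \<open>b\<close>. In the category of isometries it is the matrix
  \<open>pad\<close>.\<close>

definition inc where "inc a b = ide a \<boxplus> bang b"

lemma inc_hom: "a \<in> Obj C \<Longrightarrow> b \<in> Obj C \<Longrightarrow> inc a b \<in> hom C a (a +\<^sub>o b)"
  unfolding inc_def using plus_hom[OF id_hom bang_hom, of a b] by (simp add: plus_nul)

lemma comp_bang: "f \<in> hom C a b \<Longrightarrow> f \<cdot> bang a = bang b"
  by (intro bang_unique) (auto intro: comp_hom bang_hom hom_obj)

lemma bang_plus: "a \<in> Obj C \<Longrightarrow> b \<in> Obj C \<Longrightarrow> bang a \<boxplus> bang b = bang (a +\<^sub>o b)"
  using plus_hom[OF bang_hom bang_hom, of a b] by (intro bang_unique) (simp add: nul_plus nul_obj)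

lemma inc_nul: "a \<in> Obj C \<Longrightarrow> inc a N = ide a"
  using bang_unique[OF id_hom[OF nul_obj]] plus_id_nul[OF id_hom] by (simp add: inc_def)

text \<open>Both sides equal \<open>f \<boxplus> bang c\<close>: the interchange law is read in two
  ways, with \<open>f\<close> written as \<open>f \<boxplus> ide N\<close> on the left.\<close>

lemma inc_natural:
  assumes f: "f \<in> hom C a b" and c: "c \<in> Obj C"
  shows "inc b c \<cdot> f = (f \<boxplus> ide c) \<cdot> inc a c"
proof -
  have "inc b c \<cdot> f = (ide b \<boxplus> bang c) \<cdot> (f \<boxplus> ide N)"
    using f by (simp add: inc_def plus_id_nul)
  also have "\<dots> = f \<boxplus> bang c"
    using f c by (subst plus_comp) (auto intro: id_hom bang_hom nul_obj hom_obj simp: id_left id_right[OF bang_hom])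
  also have "\<dots> = (f \<boxplus> ide c) \<cdot> (ide a \<boxplus> bang c)"
    using f c by (subst plus_comp) (auto intro: id_hom bang_hom nul_obj hom_obj simp: id_right id_left[OF bang_hom])
  finally show ?thesis by (simp add: inc_def)
qed

text \<open>The second inclusion acts only on the added summand \<open>b\<close>, and there an arrow
  after \<open>bang\<close> is again \<open>bang\<close>.\<close>

lemma inc_comp:
  assumes "a \<in> Obj C" "b \<in> Obj C" "c \<in> Obj C"
  shows "inc (a +\<^sub>o b) c \<cdot> inc a b = inc a (b +\<^sub>o c)"
proof -
  have "inc (a +\<^sub>o b) c = ide a \<boxplus> inc b c"
    using assms by (simp add: inc_def id_plus[symmetric] plus_assoc[OF id_hom id_hom bang_hom])
  then have "inc (a +\<^sub>o b) c \<cdot> inc a b = (ide a \<boxplus> inc b c) \<cdot> (ide a \<boxplus> bang b)"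
    by (simp add: inc_def)
  also have "\<dots> = ide a \<boxplus> (inc b c \<cdot> bang b)"
    using assms by (subst plus_comp) (auto intro: id_hom inc_hom bang_hom simp: id_left[OF id_hom])
  also have "\<dots> = inc a (b +\<^sub>o c)"
    using assms by (simp add: comp_bang[OF inc_hom]) (simp add: inc_def)
  finally show ?thesis .
qed

text \<open>The source of well-definedness: an arrow acting only on the complement cannot be seen
  after the inclusion.\<close>

lemma inc_absorb:
  assumes "a \<in> Obj C" "w \<in> hom C b c"
  shows "(ide a \<boxplus> w) \<cdot> inc a b = inc a c"
  unfolding inc_def using assms hom_obj[OF assms(2)]
  by (subst plus_comp) (auto intro: id_hom bang_hom simp: id_left[OF id_hom] comp_bang)

text \<open>Naturality of the symmetry at \<open>ide c\<close> and \<open>bang b\<close>; on the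
  source side the symmetry with \<open>N\<close> is an identity.\<close>

lemma bang_plus_id:
  assumes "b \<in> Obj C" "c \<in> Obj C"
  shows "bang b \<boxplus> ide c = Gam C c b \<cdot> inc c b"
proof -
  have "Gam C c b \<cdot> (ide c \<boxplus> bang b) = (bang b \<boxplus> ide c) \<cdot> Gam C c N"
    using assms by (intro gam_natural) (auto intro: id_hom bang_hom)
  also have "\<dots> = bang b \<boxplus> ide c"
    using assms id_right[OF plus_hom[OF bang_hom id_hom], of b c] by (simp add: gam_nul nul_plus)
  finally show ?thesis by (simp add: inc_def)
qed

text \<open>The sum of the inclusions ends in a, b, c, d, but a single inclusion puts the given
  summands a, c first. Reassociating isolates \<open>bang b \<boxplus> ide c\<close>, and
  \<open>bang_plus_id\<close> introduces the required exchange.\<close>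

lemma inc_plus:
  assumes a: "a \<in> Obj C" and b: "b \<in> Obj C" and c: "c \<in> Obj C" and d: "d \<in> Obj C"
  shows "inc a b \<boxplus> inc c d = (ide a \<boxplus> (Gam C c b \<boxplus> ide d)) \<cdot> inc (a +\<^sub>o c) (b +\<^sub>o d)"
proof -
  have "inc a b \<boxplus> inc c d = ide a \<boxplus> (bang b \<boxplus> (ide c \<boxplus> bang d))"
    unfolding inc_def using assms by (simp add: plus_assoc[OF id_hom bang_hom plus_hom[OF id_hom bang_hom]])
  also have "\<dots> = ide a \<boxplus> ((bang b \<boxplus> ide c) \<boxplus> bang d)"
    using assms by (simp add: plus_assoc[OF bang_hom id_hom bang_hom])
  also have "\<dots> = ide a \<boxplus> ((Gam C c b \<cdot> inc c b) \<boxplus> (ide d \<cdot> bang d))"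
    using assms by (simp add: bang_plus_id id_left[OF bang_hom])
  also have "\<dots> = ide a \<boxplus> ((Gam C c b \<boxplus> ide d) \<cdot> (inc c b \<boxplus> bang d))"
    using assms by (simp add: plus_comp[OF inc_hom gam_hom bang_hom id_hom])
  also have "inc c b \<boxplus> bang d = inc c (b +\<^sub>o d)"
    unfolding inc_def using assms by (simp add: plus_assoc[OF id_hom bang_hom bang_hom] bang_plus)
  also have "ide a \<boxplus> ((Gam C c b \<boxplus> ide d) \<cdot> inc c (b +\<^sub>o d)) =
      (ide a \<cdot> ide a) \<boxplus> ((Gam C c b \<boxplus> ide d) \<cdot> inc c (b +\<^sub>o d))"
    using assms by (simp add: id_left[OF id_hom])
  also have "\<dots> = (ide a \<boxplus> (Gam C c b \<boxplus> ide d)) \<cdot> (ide a \<boxplus> inc c (b +\<^sub>o d))"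
  proof (rule plus_comp[symmetric])
    show "inc c (b +\<^sub>o d) \<in> hom C c (c +\<^sub>o b +\<^sub>o d)" using assms by (intro inc_hom plus_obj)
    show "Gam C c b \<boxplus> ide d \<in> hom C (c +\<^sub>o b +\<^sub>o d) ((b +\<^sub>o c) +\<^sub>o d)"
      using plus_hom[OF gam_hom[OF c b] id_hom[OF d]] assms by (simp add: plus_obj_assoc)
  qed (use a in \<open>rule id_hom\<close>)+
  also have "ide a \<boxplus> inc c (b +\<^sub>o d) = inc (a +\<^sub>o c) (b +\<^sub>o d)"
    unfolding inc_def using assms
    by (simp add: id_plus[symmetric] plus_assoc[OF id_hom id_hom bang_hom[OF plus_obj]])
  finally show ?thesis .
qed

text \<open>By strict annihilation the source is \<open>N\<close>, so initiality leaves only one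
  arrow.\<close>

lemma times_bang: "f \<in> hom C a b \<Longrightarrow> d \<in> Obj C \<Longrightarrow> f \<boxtimes> bang d = bang (b *\<^sub>o d)"
  using times_hom[OF _ bang_hom, of f a b d] by (intro bang_unique) (simp add: times_nul hom_obj)

lemma bang_times: "f \<in> hom C a b \<Longrightarrow> d \<in> Obj C \<Longrightarrow> bang d \<boxtimes> f = bang (d *\<^sub>o b)"
  using times_hom[OF bang_hom, of d f a b] by (intro bang_unique) (simp add: nul_times hom_obj)

text \<open>Naturality of the distributor at \<open>ide a\<close>, \<open>bang b\<close>,
  \<open>ide c\<close>. On the source side the second summand is \<open>N\<close>, and there the
  distributor is an identity.\<close>

lemma inc_times_id:
  assumes a: "a \<in> Obj C" and b: "b \<in> Obj C" and c: "c \<in> Obj C"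
  shows "inc a b \<boxtimes> ide c = Dsh C a b c \<cdot> inc (a *\<^sub>o c) (b *\<^sub>o c)"
proof -
  have "Dsh C a b c \<cdot> (ide a \<boxtimes> ide c \<boxplus> bang b \<boxtimes> ide c) = ((ide a \<boxplus> bang b) \<boxtimes> ide c) \<cdot> Dsh C a N c"
    using assms by (intro dsh_natural) (auto intro: id_hom bang_hom)
  also have "\<dots> = inc a b \<boxtimes> ide c"
    using assms id_right[OF times_hom[OF inc_hom id_hom], of a b c] by (simp add: dsh_nul inc_def)
  finally show ?thesis
    using assms by (simp add: inc_def id_times bang_times[OF id_hom])
qed

text \<open>Strict left distributivity splits off \<open>bang d\<close>, and
  \<open>inc_times_id\<close> treats the rest. The complement of ac in the product is therefore bc
  followed by (a + b) d, an order that fixes the shape of \<open>ext_times\<close>.\<close>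

lemma inc_times:
  assumes a: "a \<in> Obj C" and b: "b \<in> Obj C" and c: "c \<in> Obj C" and d: "d \<in> Obj C"
  shows "inc a b \<boxtimes> inc c d =
    (Dsh C a b c \<boxplus> ide ((a +\<^sub>o b) *\<^sub>o d)) \<cdot> inc (a *\<^sub>o c) (b *\<^sub>o c +\<^sub>o (a +\<^sub>o b) *\<^sub>o d)"
proof -
  let ?ac = "a *\<^sub>o c" and ?bc = "b *\<^sub>o c" and ?d = "(a +\<^sub>o b) *\<^sub>o d"
  have obj: "?ac \<in> Obj C" "?bc \<in> Obj C" "?d \<in> Obj C" "a +\<^sub>o b \<in> Obj C"
    using assms by (simp_all add: plus_obj times_obj)
  have "inc a b \<boxtimes> inc c d = inc a b \<boxtimes> ide c \<boxplus> inc a b \<boxtimes> bang d"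
    unfolding inc_def[of c d] using assms by (intro distrib[OF inc_hom id_hom bang_hom])
  also have "\<dots> = (Dsh C a b c \<cdot> inc ?ac ?bc) \<boxplus> (ide ?d \<cdot> bang ?d)"
    using assms obj by (simp add: inc_times_id times_bang[OF inc_hom] id_left[OF bang_hom])
  also have "\<dots> = (Dsh C a b c \<boxplus> ide ?d) \<cdot> (inc ?ac ?bc \<boxplus> bang ?d)"
    using assms obj by (intro plus_comp[OF inc_hom dsh_hom bang_hom id_hom, symmetric])
  also have "inc ?ac ?bc \<boxplus> bang ?d = inc ?ac (?bc +\<^sub>o ?d)"
    unfolding inc_def using obj by (simp add: plus_assoc[OF id_hom bang_hom bang_hom] bang_plus)
  finally show ?thesis .
qed

end

section \<open>Extending isometries to unitaries\<close>

text \<open>The block \<open>0\<^sub>m k 0\<close> is the empty matrix from 0 to \<open>k\<close>,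
  so this is the inclusion \<open>inc\<close> written in coordinates.\<close>

definition pad :: "nat \<Rightarrow> nat \<Rightarrow> complex mat" where
  "pad m k = dsum (1\<^sub>m m) (0\<^sub>m k 0)"

lemma dim_pad [simp]: "dim_row (pad m k) = m + k" "dim_col (pad m k) = m"
  by (simp_all add: pad_def)

lemma index_pad: "i < m + k \<Longrightarrow> j < m \<Longrightarrow> pad m k $$ (i,j) = (if i = j then 1 else 0)"
  by (simp add: pad_def)

text \<open>Multiplication by \<open>pad m k\<close> keeps the first \<open>m\<close> columns;
  \<open>U * pad m k = V\<close> thus says that \<open>U\<close> completes \<open>V\<close> by
  \<open>k\<close> further columns.\<close>

lemma index_mult_pad:
  assumes "dim_col U = m + k" "i < dim_row U" "j < m"
  shows "(U * pad m k) $$ (i,j) = U $$ (i,j)"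
proof -
  have "(U * pad m k) $$ (i,j) = (\<Sum>t<m + k. if t = j then U $$ (i,t) else 0)"
    using assms by (simp add: index_mult_sum index_pad if_distrib[of "(*) _"] cong: if_cong)
  also have "\<dots> = U $$ (i,j)" using assms by simp
  finally show ?thesis .
qed

lemma cadj_mult_diag:
  assumes "i < dim_col A"
  shows "(cadj A * A) $$ (i,i) = of_real (\<Sum>t<dim_row A. (cmod (A $$ (t,i)))\<^sup>2)"
  using assms by (simp add: index_mult_sum complex_norm_square[symmetric] mult.commute)

text \<open>\<open>Q = 1 - V V\<^sup>*\<close> is the projection onto the orthogonal complement of the range of
  an isometry \<open>V\<close>; a nonzero column of it, normalized, is a further orthonormal column for \<open>V\<close>.\<close>

definition coproj :: "complex mat \<Rightarrow> complex mat" where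
  "coproj V = 1\<^sub>m (dim_row V) - V * cadj V"

lemma dim_coproj [simp]: "dim_row (coproj V) = dim_row V" "dim_col (coproj V) = dim_row V"
  by (simp_all add: coproj_def)

lemma cadj_mult_coproj:
  assumes "isometry_mat V"
  shows "cadj V * coproj V = 0\<^sub>m (dim_col V) (dim_row V)"
proof -
  have "cadj V * coproj V = cadj V * 1\<^sub>m (dim_row V) - cadj V * (V * cadj V)"
    unfolding coproj_def
    by (rule mult_minus_distrib_mat[of _ "dim_col V" "dim_row V" _ "dim_row V"]) auto
  also have "cadj V * (V * cadj V) = cadj V"
    using assms by (subst mat_mult_assoc[symmetric]) (auto simp: isometry_mat_def)
  finally show ?thesis by (auto intro!: eq_matI)
qed

lemma cadj_minus:
  "dim_row A = dim_row B \<Longrightarrow> dim_col A = dim_col B \<Longrightarrow> cadj (A - B) = cadj A - cadj B"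
  by (rule eq_matI) auto

lemma cadj_coproj: "cadj (coproj V) = coproj V"
  by (simp add: coproj_def cadj_minus cadj_mult)

lemma coproj_idem:
  assumes "isometry_mat V"
  shows "cadj (coproj V) * coproj V = coproj V"
proof -
  have "cadj (coproj V) * coproj V = (1\<^sub>m (dim_row V) - V * cadj V) * coproj V"
    unfolding cadj_coproj by (simp add: coproj_def)
  also have "\<dots> = 1\<^sub>m (dim_row V) * coproj V - (V * cadj V) * coproj V"
    by (rule minus_mult_distrib_mat[of _ "dim_row V" "dim_row V" _ _ "dim_row V"]) auto
  also have "(V * cadj V) * coproj V = 0\<^sub>m (dim_row V) (dim_row V)"
    using assms by (subst mat_mult_assoc) (auto simp: cadj_mult_coproj)
  finally show ?thesis by (auto intro!: eq_matI)
qed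

text \<open>The trace of \<open>Q = coproj V\<close> is computed twice. As
  \<open>cadj Q * Q = Q\<close>, it is the sum of the squared norms of the columns of
  \<open>Q\<close>; by the definition of \<open>Q\<close> and exchange of summation, it is the
  number of rows minus the trace of \<open>cadj V * V\<close>, which is the number of
  columns.\<close>

lemma isometry_defect:
  assumes V: "isometry_mat V"
  shows "real (dim_row V) = real (dim_col V) +
    (\<Sum>i<dim_row V. \<Sum>t<dim_row V. (cmod (coproj V $$ (t,i)))\<^sup>2)"
proof -
  let ?n = "dim_row V" and ?m = "dim_col V" and ?Q = "coproj V"
  have "complex_of_real (\<Sum>i<?n. \<Sum>t<?n. (cmod (?Q $$ (t,i)))\<^sup>2) = (\<Sum>i<?n. (cadj ?Q * ?Q) $$ (i,i))"
    by (simp add: cadj_mult_diag)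
  also have "\<dots> = (\<Sum>i<?n. ?Q $$ (i,i))" by (simp add: coproj_idem[OF V])
  also have "\<dots> = of_nat ?n - (\<Sum>i<?n. (V * cadj V) $$ (i,i))"
    by (simp add: coproj_def sum_subtractf)
  also have "(\<Sum>i<?n. (V * cadj V) $$ (i,i)) = (\<Sum>i<?n. \<Sum>j<?m. V $$ (i,j) * cnj (V $$ (i,j)))"
    by (simp add: index_mult_sum)
  also have "\<dots> = (\<Sum>j<?m. \<Sum>i<?n. V $$ (i,j) * cnj (V $$ (i,j)))" by (rule sum.swap)
  also have "\<dots> = (\<Sum>j<?m. (cadj V * V) $$ (j,j))" by (simp add: index_mult_sum mult.commute)
  also have "\<dots> = of_nat ?m" using V by (simp add: isometry_mat_def)
  finally have "complex_of_real (\<Sum>i<?n. \<Sum>t<?n. (cmod (?Q $$ (t,i)))\<^sup>2) = of_real (real ?n - real ?m)"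
    by simp
  then show ?thesis unfolding of_real_eq_iff by simp
qed

lemma isometry_dim_le:
  assumes "isometry_mat V" shows "dim_col V \<le> dim_row V"
proof -
  have "0 \<le> (\<Sum>i<dim_row V. \<Sum>t<dim_row V. (cmod (coproj V $$ (t,i)))\<^sup>2)" by (simp add: sum_nonneg)
  then show ?thesis using isometry_defect[OF assms] by simp
qed

text \<open>Equal dimensions leave no defect, so every entry of \<open>coproj V\<close>
  vanishes.\<close>

lemma square_isometry_unitary:
  assumes V: "isometry_mat V" and sq: "dim_row V = dim_col V"
  shows "unitary_mat V"
proof -
  have *: "(\<Sum>i<dim_row V. \<Sum>t<dim_row V. (cmod (coproj V $$ (t,i)))\<^sup>2) = 0"
    using isometry_defect[OF V] sq by simp
  have "coproj V $$ (t,i) = 0" if "i < dim_row V" "t < dim_row V" for i t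
    using * that by (simp add: sum_nonneg_eq_0_iff sum_nonneg)
  then have "(V * cadj V) $$ (t,i) = 1\<^sub>m (dim_row V) $$ (t,i)" if "i < dim_row V" "t < dim_row V" for i t
    using that by (fastforce simp: coproj_def)
  then have "V * cadj V = 1\<^sub>m (dim_row V)" by (auto intro!: eq_matI)
  then show ?thesis using V sq by (simp add: unitary_mat_def isometry_mat_def)
qed

lemma isometry_extend_column:
  assumes V: "isometry_mat V" and less: "dim_col V < dim_row V"
  obtains W where "isometry_mat W" "dim_row W = dim_row V" "dim_col W = Suc (dim_col V)"
    "\<And>i j. i < dim_row V \<Longrightarrow> j < dim_col V \<Longrightarrow> W $$ (i,j) = V $$ (i,j)"
proof -
  let ?n = "dim_row V" and ?m = "dim_col V" and ?Q = "coproj V"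
  \<comment> \<open>If all entries of the projection vanished, the defect formula would make the two
    dimensions equal.\<close>
  have "\<exists>t<?n. \<exists>i<?n. ?Q $$ (i,t) \<noteq> 0"
  proof (rule ccontr)
    assume "\<not> ?thesis"
    then have "(\<Sum>i<?n. \<Sum>t<?n. (cmod (?Q $$ (t,i)))\<^sup>2) = 0" by simp
    then show False using isometry_defect[OF V] less by simp
  qed
  then obtain t i0 where t: "t < ?n" "i0 < ?n" "?Q $$ (i0,t) \<noteq> 0" by blast
  define s where "s = (\<Sum>i<?n. (cmod (?Q $$ (i,t)))\<^sup>2)"
  have "s > 0" unfolding s_def using t by (intro sum_pos2[of _ i0]) auto
  define w where "w i = ?Q $$ (i,t) / of_real (sqrt s)" for i
  have ww: "(\<Sum>i<?n. cnj (w i) * w i) = 1"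
  proof -
    have "(\<Sum>i<?n. cnj (w i) * w i) = of_real (\<Sum>i<?n. (cmod (w i))\<^sup>2)"
      by (simp add: complex_norm_square[symmetric] mult.commute)
    also have "(\<Sum>i<?n. (cmod (w i))\<^sup>2) = (\<Sum>i<?n. (cmod (?Q $$ (i,t)))\<^sup>2) / s"
      using \<open>s > 0\<close> unfolding w_def
      by (simp add: norm_divide power_divide sum_divide_distrib)
    also have "\<dots> = 1" using \<open>s > 0\<close> unfolding s_def by simp
    finally show ?thesis by simp
  qed
  \<comment> \<open>The new column is a multiple of column \<open>t\<close> of the projection, which
    \<open>cadj V\<close> annihilates.\<close>
  have Vw: "(\<Sum>i<?n. cnj (V $$ (i,j)) * w i) = 0" if "j < ?m" for j
  proof -
    have "(\<Sum>i<?n. cnj (V $$ (i,j)) * w i) = (cadj V * ?Q) $$ (j,t) / of_real (sqrt s)"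
      using that t by (simp add: index_mult_sum w_def sum_divide_distrib)
    then show ?thesis using that t by (simp add: cadj_mult_coproj[OF V])
  qed
  have wV: "(\<Sum>i<?n. cnj (w i) * V $$ (i,j)) = 0" if "j < ?m" for j
    using arg_cong[OF Vw[OF that], of cnj] by (simp add: mult.commute)
  have VV: "(\<Sum>i<?n. cnj (V $$ (i,j)) * V $$ (i,l)) = (if j = l then 1 else 0)" if "j < ?m" "l < ?m" for j l
  proof -
    have "(cadj V * V) $$ (j,l) = (\<Sum>i<?n. cnj (V $$ (i,j)) * V $$ (i,l))"
      using that by (simp add: index_mult_sum)
    then show ?thesis using V that by (simp add: isometry_mat_def)
  qed
  define W where "W = mat ?n (Suc ?m) (\<lambda>(i,j). if j < ?m then V $$ (i,j) else w i)"
  have "cadj W * W = 1\<^sub>m (Suc ?m)"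
  proof (rule eq_matI)
    fix j l assume "j < dim_row (1\<^sub>m (Suc ?m) :: complex mat)" "l < dim_col (1\<^sub>m (Suc ?m) :: complex mat)"
    then have jl: "j < Suc ?m" "l < Suc ?m" by auto
    then have "(cadj W * W) $$ (j,l) =
        (\<Sum>i<?n. cnj (if j < ?m then V $$ (i,j) else w i) * (if l < ?m then V $$ (i,l) else w i))"
      by (simp add: index_mult_sum W_def)
    also have "\<dots> = 1\<^sub>m (Suc ?m) $$ (j,l)"
      using jl ww Vw wV VV by (cases "j < ?m"; cases "l < ?m") auto
    finally show "(cadj W * W) $$ (j,l) = 1\<^sub>m (Suc ?m) $$ (j,l)" .
  qed (auto simp: W_def)
  then show thesis by (intro that[of W]) (auto simp: W_def isometry_mat_def)
qed

lemma isometry_extends_to_unitary: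
  assumes "isometry_mat V" "dim_row V = m + k" "dim_col V = m"
  shows "\<exists>U. unitary_mat U \<and> dim_col U = m + k \<and> U * pad m k = V"
proof -
  \<comment> \<open>The claim is stated by entries because \<open>m\<close> grows during the
    induction, so the shape of \<open>pad m k\<close> would change. Each step trades one missing
    column for one present column until the matrix is square.\<close>
  have "\<exists>U. unitary_mat U \<and> dim_col U = m + k \<and> (\<forall>i<m + k. \<forall>j<m. U $$ (i,j) = V $$ (i,j))"
    using assms
  proof (induction k arbitrary: m V)
    case 0
    then show ?case using square_isometry_unitary[of V] by (intro exI[of _ V]) auto
  next
    case (Suc k)
    then have "dim_col V < dim_row V" by simp
    then obtain W where W: "isometry_mat W" "dim_row W = dim_row V" "dim_col W = Suc (dim_col V)"
      "\<And>i j. i < dim_row V \<Longrightarrow> j < dim_col V \<Longrightarrow> W $$ (i,j) = V $$ (i,j)"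
      using isometry_extend_column[OF Suc.prems(1)] by blast
    obtain U where "unitary_mat U" "dim_col U = Suc m + k"
      "\<forall>i<Suc m + k. \<forall>j<Suc m. U $$ (i,j) = W $$ (i,j)"
      using Suc.IH[of W "Suc m"] W Suc.prems by auto
    then show ?case using W(4) Suc.prems by auto
  qed
  then obtain U where U: "unitary_mat U" "dim_col U = m + k" "\<forall>i<m + k. \<forall>j<m. U $$ (i,j) = V $$ (i,j)"
    by blast
  then have "dim_row U = m + k" by (simp add: unitary_mat_def)
  then have "U * pad m k = V"
    using U assms by (intro eq_matI) (auto simp: index_mult_pad)
  then show ?thesis using U by blast
qed

lemma dsum_cancel_left:
  assumes "dsum A B = dsum A B'" "dim_row B = dim_row B'" "dim_col B = dim_col B'"
  shows "B = B'"
proof (rule eq_matI)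
  fix i j assume "i < dim_row B'" "j < dim_col B'"
  then show "B $$ (i,j) = B' $$ (i,j)"
    using arg_cong[OF assms(1), of "\<lambda>X. X $$ (dim_row A + i, dim_col A + j)"] assms(2,3) by simp
qed (use assms in auto)

text \<open>The matrix \<open>X = cadj U * U'\<close> fixes \<open>pad m k\<close>, and so does its
  adjoint. Its first \<open>m\<close> columns and first \<open>m\<close> rows are therefore those of
  the identity, and \<open>W\<close> is the remaining block.\<close>

lemma unitary_extension_unique:
  assumes U: "unitary_mat U" "dim_col U = m + k" and U': "unitary_mat U'" "dim_col U' = m + k"
    and eq: "U * pad m k = U' * pad m k"
  obtains W where "unitary_mat W" "dim_col W = k" "U' = U * dsum (1\<^sub>m m) W"
proof -
  define X where "X = cadj U * U'"
  have dims [simp]: "dim_row U = m + k" "dim_row U' = m + k" "dim_col U = m + k" "dim_col U' = m + k"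
    using U U' by (auto simp: unitary_mat_def)
  have UU: "cadj U * U = 1\<^sub>m (m + k)" "U * cadj U = 1\<^sub>m (m + k)"
    using U by (simp_all add: unitary_mat_def)
  have X: "unitary_mat X" unfolding X_def using U U' by (intro unitary_mult unitary_cadj) auto
  have dX [simp]: "dim_row X = m + k" "dim_col X = m + k" by (simp_all add: X_def)
  have "X * pad m k = cadj U * (U' * pad m k)" unfolding X_def by (simp add: mat_mult_assoc)
  also have "\<dots> = (cadj U * U) * pad m k" unfolding eq[symmetric] by (simp add: mat_mult_assoc)
  finally have Xp: "X * pad m k = pad m k" by (simp add: UU)
  \<comment> \<open>A unitary that fixes \<open>pad m k\<close> has an inverse that fixes it too,
    and the inverse is the adjoint.\<close>
  have "cadj X * pad m k = cadj X * (X * pad m k)" by (simp add: Xp)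
  also have "\<dots> = (cadj X * X) * pad m k" by (simp add: mat_mult_assoc)
  finally have cXp: "cadj X * pad m k = pad m k" using X by (simp add: unitary_mat_def)
  have X1: "X $$ (i,j) = (if i = j then 1 else 0)" if "i < m + k" "j < m" for i j
    using that index_mult_pad[of X m k i j] index_pad[of i m k j] by (simp add: Xp)
  have X2: "X $$ (j,i) = (if i = j then 1 else 0)" if "i < m + k" "j < m" for i j
  proof -
    have "cnj (X $$ (j,i)) = (if i = j then 1 else 0)"
      using that index_mult_pad[of "cadj X" m k i j] index_pad[of i m k j] by (simp add: cXp)
    then show ?thesis by (metis complex_cnj_cnj complex_cnj_one complex_cnj_zero)
  qed
  define W where "W = mat k k (\<lambda>(i,j). X $$ (m + i, m + j))"
  have XW: "X = dsum (1\<^sub>m m) W"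
    by (rule eq_matI) (auto simp: X1 X2 W_def)
  have dW [simp]: "dim_row W = k" "dim_col W = k" by (simp_all add: W_def)
  have *: "dsum (1\<^sub>m m) (cadj W * W) = dsum (1\<^sub>m m) (1\<^sub>m k)"
    "dsum (1\<^sub>m m) (W * cadj W) = dsum (1\<^sub>m m) (1\<^sub>m k)"
    using X unfolding unitary_mat_def XW by (simp_all add: cadj_dsum dsum_mult)
  have "cadj W * W = 1\<^sub>m k" "W * cadj W = 1\<^sub>m k"
    by (rule dsum_cancel_left[OF *(1)]; simp) (rule dsum_cancel_left[OF *(2)]; simp)
  then have "unitary_mat W" by (simp add: unitary_mat_def)
  moreover have "U' = U * dsum (1\<^sub>m m) W"
    unfolding XW[symmetric] X_def by (simp add: mat_mult_assoc[symmetric] UU)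
  ultimately show thesis using that by simp
qed

section \<open>The extension of a functor\<close>

locale unitary_functor = bipermutative_initial C
  for C :: "('o,'m,'x) bipcat_scheme" +
  fixes Fo :: "nat \<Rightarrow> 'o" and Fm :: "complex mat \<Rightarrow> 'm"
  assumes F: "strict_bip_functor unitary_cat C Fo Fm"
begin

lemma F_obj: "Fo n \<in> Obj C"
  and F_nul: "Fo 0 = N"
  and F_unt: "Fo 1 = Unt C"
  and F_plus_obj: "Fo (m + n) = Fo m +\<^sub>o Fo n"
  and F_times_obj: "Fo (m * n) = Fo m *\<^sub>o Fo n"
  and F_id: "Fm (1\<^sub>m n) = ide (Fo n)"
  and F_gam: "Fm (swapP m n) = Gam C (Fo m) (Fo n)"
  and F_gamT: "Fm (swapT m n) = GamT C (Fo m) (Fo n)"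
  and F_hom: "unitary_mat U \<Longrightarrow> Fm U \<in> hom C (Fo (dim_col U)) (Fo (dim_row U))"
  and F_comp: "unitary_mat U \<Longrightarrow> unitary_mat U' \<Longrightarrow> dim_row U = dim_col U' \<Longrightarrow> Fm (U' * U) = Fm U' \<cdot> Fm U"
  and F_plus: "unitary_mat U \<Longrightarrow> unitary_mat U' \<Longrightarrow> Fm (dsum U U') = Fm U \<boxplus> Fm U'"
  and F_times: "unitary_mat U \<Longrightarrow> unitary_mat U' \<Longrightarrow> Fm (kron U U') = Fm U \<boxtimes> Fm U'"
  using F unfolding strict_bip_functor_def unitary_cat_eq by simp_all

lemma unitary_swaps: "unitary_mat (swapP m n)" "unitary_mat (swapT m n)" "unitary_mat (dshP m n k)"
  using unitary.swapP_closed unitary.swapT_closed unitary.dshP_closed by auto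

lemma F_dsh: "Fm (dshP a b c) = Dsh C (Fo a) (Fo b) (Fo c)"
proof -
  have "Fm (dshP a b c) = Fm (swapT c (a + b)) \<cdot> Fm (dsum (swapT a c) (swapT b c))"
    unfolding dshP_eq by (rule F_comp) (simp_all add: unitary_swaps unitary_dsum algebra_simps)
  then show ?thesis
    by (simp add: dsh_eq F_obj F_gamT F_plus unitary_swaps F_plus_obj)
qed

text \<open>The forced value at the isometry \<open>U * pad m k\<close>. It is defined on the
  unitary, not on the isometry, so that calculations stay free of choices.\<close>

definition ext :: "nat \<Rightarrow> nat \<Rightarrow> complex mat \<Rightarrow> 'm" where
  "ext m k U = Fm U \<cdot> inc (Fo m) (Fo k)"

lemma F_endo: "unitary_mat U \<Longrightarrow> dim_col U = n \<Longrightarrow> Fm U \<in> hom C (Fo n) (Fo n)"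
  using F_hom[of U] by (simp add: unitary_mat_def)

lemma inc_F_hom: "inc (Fo m) (Fo k) \<in> hom C (Fo m) (Fo (m + k))"
  using inc_hom[of "Fo m" "Fo k"] by (simp add: F_obj F_plus_obj)

lemma ext_hom: "unitary_mat U \<Longrightarrow> dim_col U = m + k \<Longrightarrow> ext m k U \<in> hom C (Fo m) (Fo (m + k))"
  unfolding ext_def by (rule comp_hom[OF inc_F_hom F_endo])

lemma ext_nul: "unitary_mat U \<Longrightarrow> dim_col U = m \<Longrightarrow> ext m 0 U = Fm U"
  unfolding ext_def by (simp add: F_nul inc_nul F_obj id_right[OF F_endo])

lemma ext_mult:
  assumes "unitary_mat U" "dim_col U = m + k" "unitary_mat U'" "dim_col U' = m + k"
  shows "ext m k (U' * U) = Fm U' \<cdot> ext m k U"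
proof -
  have "Fm (U' * U) = Fm U' \<cdot> Fm U"
    using assms by (intro F_comp) (auto simp: unitary_mat_def)
  then show ?thesis
    unfolding ext_def using comp_assoc[OF inc_F_hom F_endo F_endo] assms by simp
qed

lemma ext_absorb:
  assumes "unitary_mat U" "dim_col U = m + k" "unitary_mat W" "dim_col W = k"
  shows "ext m k (U * dsum (1\<^sub>m m) W) = ext m k U"
proof -
  have "ext m k (U * dsum (1\<^sub>m m) W) = Fm U \<cdot> ext m k (dsum (1\<^sub>m m) W)"
    using assms by (intro ext_mult) (auto simp: unitary_dsum)
  also have "ext m k (dsum (1\<^sub>m m) W) = inc (Fo m) (Fo k)"
    using assms by (simp add: ext_def F_plus F_id inc_absorb F_obj F_endo)
  finally show ?thesis by (simp add: ext_def)
qed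

text \<open>Naturality moves the second inclusion to the right past \<open>Fm U\<close>, at the cost
  of adding an identity summand to \<open>U\<close>. The two adjacent inclusions then merge by
  \<open>inc_comp\<close>.\<close>

lemma ext_comp:
  assumes U: "unitary_mat U" "dim_col U = m + k" and U': "unitary_mat U'" "dim_col U' = m + k + l"
  shows "ext (m + k) l U' \<cdot> ext m k U = ext m (k + l) (U' * dsum U (1\<^sub>m l))"
proof -
  have inc': "inc (Fo (m + k)) (Fo l) \<in> hom C (Fo (m + k)) (Fo (m + k + l))" by (rule inc_F_hom)
  have "ext (m + k) l U' \<cdot> ext m k U = Fm U' \<cdot> (inc (Fo (m + k)) (Fo l) \<cdot> ext m k U)"
    unfolding ext_def[of "m + k"] using comp_assoc[OF ext_hom[OF U] inc' F_endo[OF U']] .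
  also have "inc (Fo (m + k)) (Fo l) \<cdot> ext m k U =
      (inc (Fo (m + k)) (Fo l) \<cdot> Fm U) \<cdot> inc (Fo m) (Fo k)"
    unfolding ext_def using comp_assoc[OF inc_F_hom F_endo[OF U] inc'] by simp
  also have "inc (Fo (m + k)) (Fo l) \<cdot> Fm U = Fm (dsum U (1\<^sub>m l)) \<cdot> inc (Fo (m + k)) (Fo l)"
    using U by (simp add: inc_natural[OF F_endo[OF U] F_obj] F_plus F_id)
  also have "(Fm (dsum U (1\<^sub>m l)) \<cdot> inc (Fo (m + k)) (Fo l)) \<cdot> inc (Fo m) (Fo k) =
      Fm (dsum U (1\<^sub>m l)) \<cdot> (inc (Fo (m + k)) (Fo l) \<cdot> inc (Fo m) (Fo k))"
    using U by (intro comp_assoc[OF inc_F_hom inc' F_endo]) (auto simp: unitary_dsum)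
  also have "\<dots> = ext m (k + l) (dsum U (1\<^sub>m l))"
    by (simp add: ext_def F_plus_obj inc_comp F_obj)
  also have "Fm U' \<cdot> \<dots> = ext m (k + l) (U' * dsum U (1\<^sub>m l))"
    using U U' by (intro ext_mult[symmetric]) (auto simp: unitary_dsum)
  finally show ?thesis .
qed

lemma ext_plus:
  assumes U: "unitary_mat U" "dim_col U = m + k" and U': "unitary_mat U'" "dim_col U' = m' + k'"
  shows "ext m k U \<boxplus> ext m' k' U' =
    ext (m + m') (k + k') (dsum U U' * dsum (1\<^sub>m m) (dsum (swapP m' k) (1\<^sub>m k')))"
proof -
  let ?S = "dsum (1\<^sub>m m) (dsum (swapP m' k) (1\<^sub>m k'))"
  have S: "unitary_mat ?S" by (intro unitary_dsum unitary_swaps unitary_one)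
  have "ext m k U \<boxplus> ext m' k' U' = (Fm U \<boxplus> Fm U') \<cdot> (inc (Fo m) (Fo k) \<boxplus> inc (Fo m') (Fo k'))"
    unfolding ext_def by (rule plus_comp[OF inc_F_hom F_endo[OF U] inc_F_hom F_endo[OF U'], symmetric])
  also have "inc (Fo m) (Fo k) \<boxplus> inc (Fo m') (Fo k') = ext (m + m') (k + k') ?S"
    by (simp add: inc_plus F_obj ext_def F_plus F_gam F_id F_plus_obj unitary_dsum unitary_swaps)
  also have "(Fm U \<boxplus> Fm U') \<cdot> \<dots> = ext (m + m') (k + k') (dsum U U' * ?S)"
    using U U' S by (subst ext_mult) (simp_all add: unitary_dsum F_plus)
  finally show ?thesis .
qed

lemma ext_times:
  assumes U: "unitary_mat U" "dim_col U = m + k" and U': "unitary_mat U'" "dim_col U' = m' + k'"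
  shows "ext m k U \<boxtimes> ext m' k' U' =
    ext (m * m') (k * m' + (m + k) * k') (kron U U' * dsum (dshP m k m') (1\<^sub>m ((m + k) * k')))"
proof -
  let ?S = "dsum (dshP m k m') (1\<^sub>m ((m + k) * k'))"
  have S: "unitary_mat ?S" by (intro unitary_dsum unitary_swaps unitary_one)
  have "ext m k U \<boxtimes> ext m' k' U' = (Fm U \<boxtimes> Fm U') \<cdot> (inc (Fo m) (Fo k) \<boxtimes> inc (Fo m') (Fo k'))"
    unfolding ext_def by (rule times_comp[OF inc_F_hom F_endo[OF U] inc_F_hom F_endo[OF U'], symmetric])
  also have "inc (Fo m) (Fo k) \<boxtimes> inc (Fo m') (Fo k') = ext (m * m') (k * m' + (m + k) * k') ?S"
    by (simp only: inc_times F_obj ext_def F_plus F_dsh F_id F_plus_obj F_times_obj unitary_swaps unitary_one)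
  also have "(Fm U \<boxtimes> Fm U') \<cdot> \<dots> = ext (m * m') (k * m' + (m + k) * k') (kron U U' * ?S)"
    using U U' S by (subst ext_mult) (simp_all add: unitary_kron F_times algebra_simps)
  finally show ?thesis .
qed

end

section \<open>Isometries as values of \<open>ext\<close> for the inclusion functor\<close>

interpretation J: unitary_functor isometry_cat J_obj J_mor
  by standard (rule bipermutative_isometry initial_isometry strict_bip_functor_J)+

lemma isometry_bang: "J.bang n = 0\<^sub>m n 0"
  by (rule J.bang_unique[symmetric])
     (auto simp: isometry_cat_eq hom_def isometry_mat_def intro!: eq_matI)

lemma J_ext: "J.ext m k U = U * pad m k"
  by (simp add: J.ext_def J.inc_def isometry_bang) (simp add: isometry_cat_eq J_obj_def J_mor_def pad_def)

lemma isometry_as_ext: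
  assumes "isometry_mat V"
  obtains m k U where "unitary_mat U" "dim_col U = m + k" "V = J.ext m k U"
proof -
  obtain k where "dim_row V = dim_col V + k" using isometry_dim_le[OF assms] le_Suc_ex by blast
  then show thesis using isometry_extends_to_unitary[OF assms] that by (metis J_ext)
qed

section \<open>The lifted functor and its uniqueness\<close>

context unitary_functor
begin

text \<open>The unitary completion is picked by choice; \<open>lift_ext\<close> shows that the
  choice does not matter. The truncated subtraction is exact on isometries, by
  \<open>isometry_dim_le\<close>.\<close>

definition lift :: "complex mat \<Rightarrow> 'm" where
  "lift V = (let m = dim_col V; k = dim_row V - dim_col V
     in ext m k (SOME U. unitary_mat U \<and> dim_col U = m + k \<and> J.ext m k U = V))"

lemma lift_ext:
  assumes U: "unitary_mat U" "dim_col U = m + k"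
  shows "lift (J.ext m k U) = ext m k U"
proof -
  have dims: "dim_col (J.ext m k U) = m" "dim_row (J.ext m k U) - m = k"
    using U by (simp_all add: J_ext unitary_mat_def)
  let ?P = "\<lambda>U'. unitary_mat U' \<and> dim_col U' = m + k \<and> J.ext m k U' = J.ext m k U"
  define U' where "U' = (SOME U'. ?P U')"
  have "?P U'" unfolding U'_def by (rule someI[of ?P U]) (use U in simp)
  then obtain W where "unitary_mat W" "dim_col W = k" "U = U' * dsum (1\<^sub>m m) W"
    using unitary_extension_unique[of U' m k U] U by (metis J_ext)
  then have "ext m k U = ext m k U'" using ext_absorb \<open>?P U'\<close> by simp
  moreover have "lift (J.ext m k U) = ext m k U'"
    unfolding lift_def Let_def dims U'_def ..
  ultimately show ?thesis by simp
qed

lemma lift_unitary: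
  assumes "unitary_mat U" shows "lift U = Fm U"
proof -
  \<comment> \<open>A unitary is the case \<open>k = 0\<close>, where the inclusion is an
    identity.\<close>
  have "J.ext (dim_col U) 0 U = U" using J.ext_nul[OF assms refl] by (simp add: J_mor_def)
  then show ?thesis using lift_ext[of U "dim_col U" 0] assms by (simp add: ext_nul)
qed

lemma strict_bip_functor_lift: "strict_bip_functor isometry_cat C Fo lift"
proof -
  have hom: "lift V \<in> hom C (Fo (dim_col V)) (Fo (dim_row V))" if "isometry_mat V" for V
    using isometry_as_ext[OF that]
    by (metis J_ext dim_pad(2) index_mult_mat(2,3) lift_ext ext_hom unitary_mat_def)
  have comp: "lift (V' * V) = lift V' \<cdot> lift V"
    if V: "isometry_mat V" and V': "isometry_mat V'" and d: "dim_row V = dim_col V'" for V V'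
  proof -
    obtain m k U where U: "unitary_mat U" "dim_col U = m + k" "V = J.ext m k U"
      using isometry_as_ext[OF V] .
    obtain m' l U' where U': "unitary_mat U'" "dim_col U' = m' + l" "V' = J.ext m' l U'"
      using isometry_as_ext[OF V'] .
    have m': "m' = m + k" using d U U' by (simp add: J_ext unitary_mat_def)
    \<comment> \<open>This is \<open>ext_comp\<close> for the inclusion functor, read as a matrix
      equation. The same lemma for \<open>C\<close> has the same unitary on its right side, so
      \<open>lift_ext\<close> closes the gap.\<close>
    have "V' * V = J.ext m (k + l) (U' * dsum U (1\<^sub>m l))"
      using J.ext_comp[OF U(1,2), of U' l] U U' m' by (simp add: isometry_cat_eq)
    moreover have "unitary_mat (U' * dsum U (1\<^sub>m l))"
      using U U' m' by (intro unitary_mult unitary_dsum) (auto simp: unitary_mat_def)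
    ultimately show ?thesis
      using U U' m' by (simp add: lift_ext ext_comp)
  qed
  have plus: "lift (dsum V V') = lift V \<boxplus> lift V'" and times: "lift (kron V V') = lift V \<boxtimes> lift V'"
    if V: "isometry_mat V" and V': "isometry_mat V'" for V V'
  proof -
    obtain m k U where U: "unitary_mat U" "dim_col U = m + k" "V = J.ext m k U"
      using isometry_as_ext[OF V] .
    obtain m' k' U' where U': "unitary_mat U'" "dim_col U' = m' + k'" "V' = J.ext m' k' U'"
      using isometry_as_ext[OF V'] .
    let ?S = "dsum (1\<^sub>m m) (dsum (swapP m' k) (1\<^sub>m k'))"
    let ?T = "dsum (dshP m k m') (1\<^sub>m ((m + k) * k'))"
    have "dsum V V' = J.ext (m + m') (k + k') (dsum U U' * ?S)"
      using J.ext_plus[OF U(1,2) U'(1,2)] U U' by (simp add: isometry_cat_eq)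
    moreover have "unitary_mat (dsum U U' * ?S)"
      using U U' by (intro unitary_mult unitary_dsum unitary_swaps unitary_one) auto
    ultimately show "lift (dsum V V') = lift V \<boxplus> lift V'"
      using U U' by (simp add: lift_ext ext_plus)
    have "kron V V' = J.ext (m * m') (k * m' + (m + k) * k') (kron U U' * ?T)"
      using J.ext_times[OF U(1,2) U'(1,2)] U U' by (simp add: isometry_cat_eq)
    moreover have "unitary_mat (kron U U' * ?T)"
      using U U' by (intro unitary_mult unitary_dsum unitary_kron unitary_swaps unitary_one) (auto simp: algebra_simps)
    ultimately show "lift (kron V V') = lift V \<boxtimes> lift V'"
      using U U' by (simp add: lift_ext ext_times algebra_simps)
  qed
  show ?thesis
    unfolding strict_bip_functor_def isometry_cat_eq
    by (simp add: hom comp plus times F_obj F_nul F_unt[unfolded One_nat_def] F_plus_obj F_times_obj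
        lift_unitary unitary_swaps F_id F_gam F_gamT)
qed

lemma lift_unique:
  assumes G: "strict_bip_functor isometry_cat C Go Gm"
    and Go: "\<And>n. Go n = Fo n" and Gm: "\<And>U. unitary_mat U \<Longrightarrow> Gm U = Fm U"
    and V: "isometry_mat V"
  shows "Gm V = lift V"
proof -
  obtain m k U where U: "unitary_mat U" "dim_col U = m + k" "V = J.ext m k U"
    using isometry_as_ext[OF V] .
  have G_comp: "Gm (W * V) = Gm W \<cdot> Gm V"
    if "isometry_mat V" "isometry_mat W" "dim_row V = dim_col W" for V W
    using G that unfolding strict_bip_functor_def isometry_cat_eq by simp
  have G_plus: "Gm (dsum V W) = Gm V \<boxplus> Gm W" if "isometry_mat V" "isometry_mat W" for V W
    using G that unfolding strict_bip_functor_def isometry_cat_eq by simp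
  have G_hom: "Gm V \<in> hom C (Go (dim_col V)) (Go (dim_row V))" if "isometry_mat V" for V
    using G that unfolding strict_bip_functor_def isometry_cat_eq by simp
  have bang: "isometry_mat (0\<^sub>m k 0)" by (auto simp: isometry_mat_def intro!: eq_matI)
  have U_iso: "isometry_mat U" "isometry_mat (1\<^sub>m m)" using U by (simp_all add: unitary_iff_isometry isometry_mat_def)
  \<comment> \<open>The image of the empty matrix starts at \<open>Fo 0 = N\<close>, so initiality
    determines it. Preservation of sums then determines the image of \<open>pad m k\<close>.\<close>
  have "Gm (0\<^sub>m k 0) = bang (Fo k)"
    using G_hom[OF bang] by (intro bang_unique) (simp add: Go F_nul)
  then have "Gm (pad m k) = inc (Fo m) (Fo k)"
    unfolding pad_def inc_def using U_iso bang by (simp add: G_plus Gm F_id)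
  moreover have "Gm V = Gm U \<cdot> Gm (pad m k)"
    unfolding U(3) J_ext using U U_iso bang by (intro G_comp) (auto simp: pad_def isometry_dsum)
  ultimately have "Gm V = ext m k U" by (simp add: ext_def Gm U)
  then show ?thesis using U by (simp add: lift_ext)
qed

end

theorem mainTheorem3:
  shows "bipermutative unitary_cat \<and> bipermutative isometry_cat \<and>
    strict_bip_functor unitary_cat isometry_cat J_obj J_mor \<and>
    (\<forall>(C :: ('o,'m) bipcat) (Fo :: nat \<Rightarrow> 'o) (Fm :: complex mat \<Rightarrow> 'm).
       bipermutative C \<and> initial_obj C (Nul C) \<and> strict_bip_functor unitary_cat C Fo Fm \<longrightarrow>
       (\<exists>Go Gm. strict_bip_functor isometry_cat C Go Gm \<and>
          (\<forall>n\<in>Obj unitary_cat. Go (J_obj n) = Fo n) \<and>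
          (\<forall>U\<in>Arr unitary_cat. Gm (J_mor U) = Fm U) \<and>
          (\<forall>Go' Gm'. strict_bip_functor isometry_cat C Go' Gm' \<and>
               (\<forall>n\<in>Obj unitary_cat. Go' (J_obj n) = Fo n) \<and>
               (\<forall>U\<in>Arr unitary_cat. Gm' (J_mor U) = Fm U) \<longrightarrow>
             (\<forall>n\<in>Obj isometry_cat. Go' n = Go n) \<and> (\<forall>V\<in>Arr isometry_cat. Gm' V = Gm V))))"
proof (intro conjI allI impI bipermutative_unitary bipermutative_isometry strict_bip_functor_J, elim conjE)
  fix C :: "('o,'m) bipcat" and Fo Fm
  assume "bipermutative C" "initial_obj C (Nul C)" "strict_bip_functor unitary_cat C Fo Fm"
  then interpret unitary_functor C Fo Fm by unfold_locales
  show "\<exists>Go Gm. strict_bip_functor isometry_cat C Go Gm \<and>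
          (\<forall>n\<in>Obj unitary_cat. Go (J_obj n) = Fo n) \<and>
          (\<forall>U\<in>Arr unitary_cat. Gm (J_mor U) = Fm U) \<and>
          (\<forall>Go' Gm'. strict_bip_functor isometry_cat C Go' Gm' \<and>
               (\<forall>n\<in>Obj unitary_cat. Go' (J_obj n) = Fo n) \<and>
               (\<forall>U\<in>Arr unitary_cat. Gm' (J_mor U) = Fm U) \<longrightarrow>
             (\<forall>n\<in>Obj isometry_cat. Go' n = Go n) \<and> (\<forall>V\<in>Arr isometry_cat. Gm' V = Gm V))"
    \<comment> \<open>As \<open>J_obj\<close> is the identity, the object part must be
      \<open>Fo\<close>, which also settles uniqueness on objects.\<close>
    using strict_bip_functor_lift
    by (intro exI[of _ Fo] exI[of _ lift])
       (auto simp: J_obj_def J_mor_def unitary_cat_eq isometry_cat_eq lift_unitary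
         intro: lift_unique[unfolded isometry_cat_eq])
qed

end
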